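(* Let $(\Sigma,g)$ be an $n$-dimensional submanifold of a pseudo-Riemannian manifold $(M,\eta)$, with induced (nondegenerate) metric $g$, equipped with an $(N+1)$-multilinear bracket satisfying the compatibility relation described in the context. For a normal vector field $N=N^i\partial_i\in T\Sigma^\perp$ let $\mathcal{B}_N:TM\to TM$ be the map defined in the context. Then for all $X\in T\Sigma$ and $N,\tilde N\in T\Sigma^\perp$, $$\mathcal{B}_N(X)=W_N(X),\qquad \eta\big(\mathcal{B}_N(\tilde N),X\big)=-\eta\big(D_XN,\tilde N\big),$$ where $W_N(X)\in T\Sigma$ and $D_XN\in T\Sigma^\perp$ are determined by the Weingarten decomposition $\bar\nabla_XN=-W_N(X)+D_XN$ into tangential and normal parts.
   Context: Setting. $(M,\eta)$ is a pseudo-Riemannian manifold of dimension $m$ with Levi-Civita connection $\bar\nabla$ (Christoffel symbols $\bar\Gamma^i_{jk}$) and local coordinates $x^1,\dots,x^m$; $(\Sigma,g)$ is an $n$-dimensional submanifold with induced nondegenerate metric $g$, given locally by $x^i(u^1,\dots,u^n)$. Everything is local in these coordinates. Indices $i,j,k,\dots$ run over $1,\dots,m$ and are raised and lowered with $\eta$; $a,b,c,\dots$ run over $1,\dots,n$; repeated indices are summed. $T\Sigma$ is regarded as a subspace of $TM$ (along $\Sigma$) with basis $e_a=(\partial_a x^i)\partial_i$; $g_{ab}=\eta(e_a,e_b)$, with inverse $g^{ab}$; $T\Sigma^\perp$ is its $\eta$-orthogonal complement. Bracket. (In this paragraph the integer $N$ is the bracket order and is unrelated to the normal vector $N$.) $\{\cdot,\dots,\cdot\}$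 is an $(N+1)$-multilinear map $C^\infty(\Sigma)^{N+1}\to C^\infty(\Sigma)$ satisfying the Leibniz rule in each argument (antisymmetry is not assumed). For a multi-index $I=(i_1\cdots i_N)$ write $\{f,\vec x^I\}=\{f,x^{i_1},\dots,x^{i_N}\}$, $\eta_{IJ}=\eta_{i_1j_1}\cdots\eta_{i_Nj_N}$ and $\mathcal{P}^{iI}=\frac1{\sqrt{N!}}\{x^i,\vec x^I\}$. Compatibility assumption: there are $\gamma\in C^\infty(\Sigma)$ with $\gamma>0$ and $\epsilon\in\{-1,1\}$ such that $\mathcal{P}^{iI}\mathcal{P}^{jJ}\eta_{IJ}=\epsilon\gamma^2g^{ab}(\partial_ax^i)(\partial_bx^j)$. Derived objects. $\mathcal{D}^{ij}=\frac{\epsilon}{\gamma^2}\mathcal{P}^{iI}\mathcal{P}^{jJ}\eta_{IJ}$, $\mathcal{D}(X)=\mathcal{D}^{ij}\eta_{jk}X^k\partial_i$ for $X\in TM$; $\hat\nabla_XY=\bar\nabla_{\mathcal{D}(X)}Y$, i.e. $\hat\nabla^i=\mathcal{D}^{il}\bar\nabla_l$ (this differentiates only in directions tangent to $\Sigma$). For a normal vector field $N=N^i\partial_i$, $$\mathcal{B}_N^{ij}=-\hat\nabla^iN^j=-\tfrac{\epsilon}{\gamma^2N!}\{x^i,\vec x^I\}\{N^j,\vec x^J\}\eta_{IJ}-\tfrac{\epsilon}{\gamma^2N!}\{x^i,\vec x^I\}\{x^k,\vec x^J\}\eta_{IJ}\bar\Gamma^j_{kl}N^l$$ (with $N!$ the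 factorial of the bracket order), and $\mathcal{B}_N(X)=\mathcal{B}_N^{ij}\eta_{jk}X^k\partial_i$ for $X\in TM$. *)

theory Defs
  imports "HOL-Analysis.Analysis"
begin

section \<open>Smooth functions\<close>

primrec higher_differentiable_on ::
  "nat \<Rightarrow> 'a::real_normed_vector set \<Rightarrow> ('a \<Rightarrow> 'b::real_normed_vector) \<Rightarrow> bool" where
  "higher_differentiable_on 0 S f \<longleftrightarrow> continuous_on S f"
| "higher_differentiable_on (Suc k) S f \<longleftrightarrow>
     (\<forall>u\<in>S. f differentiable (at u)) \<and>
     (\<forall>v. higher_differentiable_on k S (\<lambda>u. frechet_derivative f (at u) v))"

text \<open>Only meaningful for open \<open>S\<close>; then it says that \<open>f\<close> is of class \<open>C\<^sup>\<infinity>\<close> on \<open>S\<close>.\<close>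
definition smooth_on ::
  "'a::real_normed_vector set \<Rightarrow> ('a \<Rightarrow> 'b::real_normed_vector) \<Rightarrow> bool" where
  "smooth_on S f \<longleftrightarrow> (\<forall>k. higher_differentiable_on k S f)"

definition partial ::
  "'i::finite \<Rightarrow> (real ^ 'i \<Rightarrow> 'b::real_normed_vector) \<Rightarrow> real ^ 'i \<Rightarrow> 'b" where
  "partial a f u = frechet_derivative f (at u) (axis a 1)"


section \<open>The ambient metric and its Levi-Civita connection\<close>

text \<open>The ambient manifold is represented by the open image \<open>M\<close> of a coordinate chart, its metric
  by the matrix-valued function \<open>\<eta>\<close> with entries \<open>\<eta> p $ i $ j\<close>.  Tangent vectors at \<open>p\<close> are
  identified with their components with respect to the coordinate vector fields.  The signature is
  not fixed; by continuity it is constant on each component of \<open>M\<close>.\<close>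
definition pseudo_riemannian_metric ::
  "(real ^ 'm) set \<Rightarrow> (real ^ 'm \<Rightarrow> real ^ 'm ^ 'm) \<Rightarrow> bool" where
  "pseudo_riemannian_metric M \<eta> \<longleftrightarrow>
     open M \<and> smooth_on M \<eta> \<and> (\<forall>p\<in>M. transpose (\<eta> p) = \<eta> p \<and> invertible (\<eta> p))"

definition form :: "real ^ 'm ^ 'm \<Rightarrow> real ^ 'm \<Rightarrow> real ^ 'm \<Rightarrow> real" where
  "form A X Y = (\<Sum>i\<in>UNIV. \<Sum>j\<in>UNIV. A $ i $ j * X $ i * Y $ j)"

definition christoffel ::
  "(real ^ 'm \<Rightarrow> real ^ 'm ^ 'm) \<Rightarrow> real ^ 'm \<Rightarrow> 'm \<Rightarrow> 'm \<Rightarrow> 'm \<Rightarrow> real" where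
  "christoffel \<eta> p i j k =
     (1/2) * (\<Sum>l\<in>UNIV. matrix_inv (\<eta> p) $ i $ l *
       (partial j (\<lambda>q. \<eta> q $ l $ k) p + partial k (\<lambda>q. \<eta> q $ l $ j) p
         - partial l (\<lambda>q. \<eta> q $ j $ k) p))"


section \<open>Submanifolds\<close>

text \<open>The submanifold is given by a local parametrization \<open>x\<close> on an open parameter domain \<open>U\<close>.
  Functions and vector fields along the submanifold are functions of the parameter \<open>u\<close>.\<close>

definition tangent_space :: "(real ^ 'n \<Rightarrow> real ^ 'm) \<Rightarrow> real ^ 'n \<Rightarrow> (real ^ 'm) set" where
  "tangent_space x u = span (range (\<lambda>a. partial a x u))"

definition normal_complement ::
  "(real ^ 'm \<Rightarrow> real ^ 'm ^ 'm) \<Rightarrow> (real ^ 'n \<Rightarrow> real ^ 'm) \<Rightarrow> real ^ 'n \<Rightarrow> (real ^ 'm) set" where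
  "normal_complement \<eta> x u = {V. \<forall>X\<in>tangent_space x u. form (\<eta> (x u)) X V = 0}"

definition induced_metric ::
  "(real ^ 'm \<Rightarrow> real ^ 'm ^ 'm) \<Rightarrow> (real ^ 'n \<Rightarrow> real ^ 'm) \<Rightarrow> real ^ 'n \<Rightarrow> real ^ 'n ^ 'n" where
  "induced_metric \<eta> x u = (\<chi> a b. form (\<eta> (x u)) (partial a x u) (partial b x u))"

definition nondegenerate_submanifold ::
  "(real ^ 'm) set \<Rightarrow> (real ^ 'm \<Rightarrow> real ^ 'm ^ 'm) \<Rightarrow>
   (real ^ 'n) set \<Rightarrow> (real ^ 'n \<Rightarrow> real ^ 'm) \<Rightarrow> bool" where
  "nondegenerate_submanifold M \<eta> U x \<longleftrightarrow>
     open U \<and> smooth_on U x \<and> x ` U \<subseteq> M \<and>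
     (\<forall>u\<in>U. inj (frechet_derivative x (at u)) \<and> invertible (induced_metric \<eta> x u))"

definition tangent_coords :: "(real ^ 'n \<Rightarrow> real ^ 'm) \<Rightarrow> real ^ 'n \<Rightarrow> real ^ 'm \<Rightarrow> real ^ 'n" where
  "tangent_coords x u X = (THE t. X = (\<Sum>a\<in>UNIV. t $ a *\<^sub>R partial a x u))"

text \<open>Ambient covariant derivative of a vector field \<open>Y\<close> along the submanifold in the direction of
  a tangent vector \<open>X\<close> of the submanifold (no extension of \<open>Y\<close> off the submanifold is needed).\<close>
definition nabla_bar ::
  "(real ^ 'm \<Rightarrow> real ^ 'm ^ 'm) \<Rightarrow> (real ^ 'n \<Rightarrow> real ^ 'm) \<Rightarrow>
   (real ^ 'n \<Rightarrow> real ^ 'm) \<Rightarrow> real ^ 'n \<Rightarrow> real ^ 'm \<Rightarrow> real ^ 'm" where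
  "nabla_bar \<eta> x Y u X = (\<chi> i.
     (\<Sum>a\<in>UNIV. tangent_coords x u X $ a * partial a (\<lambda>v. Y v $ i) u)
     + (\<Sum>j\<in>UNIV. \<Sum>k\<in>UNIV. christoffel \<eta> (x u) i j k * X $ j * Y u $ k))"

definition weingarten_map ::
  "(real ^ 'm \<Rightarrow> real ^ 'm ^ 'm) \<Rightarrow> (real ^ 'n \<Rightarrow> real ^ 'm) \<Rightarrow>
   (real ^ 'n \<Rightarrow> real ^ 'm) \<Rightarrow> real ^ 'n \<Rightarrow> real ^ 'm \<Rightarrow> real ^ 'm" where
  "weingarten_map \<eta> x N u X =
     (THE W. W \<in> tangent_space x u \<and>
        (\<exists>V\<in>normal_complement \<eta> x u. nabla_bar \<eta> x N u X = - W + V))"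

definition normal_connection ::
  "(real ^ 'm \<Rightarrow> real ^ 'm ^ 'm) \<Rightarrow> (real ^ 'n \<Rightarrow> real ^ 'm) \<Rightarrow>
   (real ^ 'n \<Rightarrow> real ^ 'm) \<Rightarrow> real ^ 'n \<Rightarrow> real ^ 'm \<Rightarrow> real ^ 'm" where
  "normal_connection \<eta> x N u X =
     (THE V. V \<in> normal_complement \<eta> x u \<and>
        (\<exists>W\<in>tangent_space x u. nabla_bar \<eta> x N u X = - W + V))"

text \<open>The definite descriptions above are proper at every point where the induced metric is
  invertible.\<close>

lemma form_sum_right:
  "form A X (\<Sum>a\<in>S. t a *\<^sub>R e a) = (\<Sum>a\<in>S. t a * form A X (e a))"
proof -
  have "form A X (\<Sum>a\<in>S. t a *\<^sub>R e a)
      = (\<Sum>i\<in>UNIV. \<Sum>j\<in>UNIV. \<Sum>a\<in>S. A $ i $ j * X $ i * (t a * e a $ j))"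
    by (simp add: form_def sum_distrib_left)
  also have "\<dots> = (\<Sum>i\<in>UNIV. \<Sum>a\<in>S. \<Sum>j\<in>UNIV. A $ i $ j * X $ i * (t a * e a $ j))"
    by (intro sum.cong refl sum.swap)
  also have "\<dots> = (\<Sum>a\<in>S. \<Sum>i\<in>UNIV. \<Sum>j\<in>UNIV. A $ i $ j * X $ i * (t a * e a $ j))"
    by (rule sum.swap)
  finally show ?thesis
    by (simp add: form_def sum_distrib_left mult_ac)
qed

lemma form_diff_right: "form A X (Y - Z) = form A X Y - form A X Z"
  by (simp add: form_def algebra_simps sum_subtractf)

lemma form_transpose: "form (transpose A) X Y = form A Y X"
  unfolding form_def transpose_def by (subst sum.swap) (simp add: mult_ac)

lemma form_sum_left:
  "form A (\<Sum>a\<in>S. t a *\<^sub>R e a) Y = (\<Sum>a\<in>S. t a * form A (e a) Y)"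
  using form_sum_right[of "transpose A" Y t e S] by (simp add: form_transpose)

lemma tangent_space_iff:
  "X \<in> tangent_space x u \<longleftrightarrow> (\<exists>t. X = (\<Sum>a\<in>UNIV. t $ a *\<^sub>R partial a x u))"
proof
  assume "X \<in> tangent_space x u"
  then show "\<exists>t. X = (\<Sum>a\<in>UNIV. t $ a *\<^sub>R partial a x u)"
    unfolding tangent_space_def
  proof (induction rule: span_induct_alt)
    case base
    show ?case by (intro exI[of _ 0]) simp
  next
    case (step c X Y)
    then obtain t b where "Y = (\<Sum>a\<in>UNIV. t $ a *\<^sub>R partial a x u)" "X = partial b x u"
      by auto
    moreover have "(\<Sum>a\<in>UNIV. (axis b c :: real ^ _) $ a *\<^sub>R partial a x u) = c *\<^sub>R partial b x u"
      by (simp add: axis_def if_distrib[of "\<lambda>r. r *\<^sub>R _"] cong: if_cong)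
    ultimately show ?case
      by (intro exI[of _ "axis b c + t"]) (simp add: scaleR_add_left sum.distrib)
  qed
next
  assume "\<exists>t. X = (\<Sum>a\<in>UNIV. t $ a *\<^sub>R partial a x u)"
  then show "X \<in> tangent_space x u"
    unfolding tangent_space_def by (auto intro!: span_sum intro: span_scale span_base)
qed

lemma form_tangent:
  "form (\<eta> (x u)) (partial b x u) (\<Sum>a\<in>UNIV. t $ a *\<^sub>R partial a x u)
     = (induced_metric \<eta> x u *v t) $ b"
  by (simp add: form_sum_right induced_metric_def matrix_vector_mult_def mult_ac)

lemma normal_complement_iff:
  "V \<in> normal_complement \<eta> x u \<longleftrightarrow> (\<forall>a. form (\<eta> (x u)) (partial a x u) V = 0)"
proof
  assume "V \<in> normal_complement \<eta> x u"
  then show "\<forall>a. form (\<eta> (x u)) (partial a x u) V = 0"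
    by (auto simp: normal_complement_def tangent_space_def intro: span_base)
next
  assume "\<forall>a. form (\<eta> (x u)) (partial a x u) V = 0"
  then show "V \<in> normal_complement \<eta> x u"
    by (auto simp: normal_complement_def tangent_space_iff form_sum_left)
qed

lemma tangent_coords_unique:
  assumes "invertible (induced_metric \<eta> x u)" "X \<in> tangent_space x u"
  shows "\<exists>!t. X = (\<Sum>a\<in>UNIV. t $ a *\<^sub>R partial a x u)"
proof -
  have "s = t" if "(\<Sum>a\<in>UNIV. s $ a *\<^sub>R partial a x u) = (\<Sum>a\<in>UNIV. t $ a *\<^sub>R partial a x u)" for s t
  proof -
    have "induced_metric \<eta> x u *v s = induced_metric \<eta> x u *v t"
      by (simp add: vec_eq_iff that flip: form_tangent)
    then show ?thesis
      using inj_matrix_vector_mult[OF assms(1)] by (simp add: inj_eq)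
  qed
  moreover have "\<exists>t. X = (\<Sum>a\<in>UNIV. t $ a *\<^sub>R partial a x u)"
    using assms(2) by (simp add: tangent_space_iff)
  ultimately show ?thesis
    by (auto intro!: ex_ex1I)
qed

lemma weingarten_decomposition:
  assumes "invertible (induced_metric \<eta> x u)"
  shows "\<exists>!W. W \<in> tangent_space x u \<and> (\<exists>V\<in>normal_complement \<eta> x u. Y = - W + V)"
    and "\<exists>!V. V \<in> normal_complement \<eta> x u \<and> (\<exists>W\<in>tangent_space x u. Y = - W + V)"
proof -
  let ?G = "induced_metric \<eta> x u"
  let ?e = "\<lambda>t. \<Sum>a\<in>UNIV. t $ a *\<^sub>R partial a x u"
  have ex: "\<exists>W\<in>tangent_space x u. \<exists>V\<in>normal_complement \<eta> x u. Y = - W + V"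
  proof -
    have "?G ** matrix_inv ?G = mat 1"
      using someI_ex[OF assms[unfolded invertible_def]] unfolding matrix_inv_def by simp
    moreover define t where "t = matrix_inv ?G *v (\<chi> b. form (\<eta> (x u)) (partial b x u) Y)"
    ultimately have "?G *v t = (\<chi> b. form (\<eta> (x u)) (partial b x u) Y)"
      by (simp add: matrix_vector_mul_assoc)
    then have "Y - ?e t \<in> normal_complement \<eta> x u"
      by (simp add: normal_complement_iff form_diff_right form_tangent)
    moreover have "- ?e t \<in> tangent_space x u"
      unfolding tangent_space_def
      by (intro span_neg span_sum span_scale span_base rangeI)
    moreover have "Y = - (- ?e t) + (Y - ?e t)" by simp
    ultimately show ?thesis by blast
  qed
  have un: "W = W' \<and> V = V'"
    if "W \<in> tangent_space x u" "W' \<in> tangent_space x u" "V \<in> normal_complement \<eta> x u"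
      "V' \<in> normal_complement \<eta> x u" "- W + V = - W' + V'" for W W' V V'
  proof -
    have "W - W' \<in> tangent_space x u"
      using that unfolding tangent_space_def by (simp add: span_diff)
    then obtain t where t: "W - W' = ?e t" by (auto simp: tangent_space_iff)
    have "V - V' = W - W'" using that(5) by (simp add: algebra_simps)
    then have "\<forall>b. form (\<eta> (x u)) (partial b x u) (?e t) = 0"
      unfolding t[symmetric] \<open>V - V' = W - W'\<close>[symmetric] using that(3,4) by (simp add: normal_complement_iff form_diff_right)
    then have "?G *v t = ?G *v 0" by (simp add: form_tangent vec_eq_iff)
    then have "t = 0" using inj_matrix_vector_mult[OF assms] by (simp only: inj_eq)
    then have "W = W'" using t by simp
    then show ?thesis using that(5) by simp
  qed
  show "\<exists>!W. W \<in> tangent_space x u \<and> (\<exists>V\<in>normal_complement \<eta> x u. Y = - W + V)"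
    and "\<exists>!V. V \<in> normal_complement \<eta> x u \<and> (\<exists>W\<in>tangent_space x u. Y = - W + V)"
    subgoal using ex un by (intro ex_ex1I) blast+
    subgoal using ex un by (intro ex_ex1I) blast+
    done
qed



section \<open>Multilinear brackets\<close>

text \<open>A bracket of order \<open>p\<close> takes \<open>p + 1\<close> smooth functions, passed as a list.  Smooth functions on
  \<open>U\<close> are represented by total functions whose values outside \<open>U\<close> are irrelevant; hence the
  congruence condition.\<close>
definition leibniz_bracket ::
  "nat \<Rightarrow> (real ^ 'n) set \<Rightarrow> ((real ^ 'n \<Rightarrow> real) list \<Rightarrow> real ^ 'n \<Rightarrow> real) \<Rightarrow> bool" where
  "leibniz_bracket p U br \<longleftrightarrow>
     (\<forall>fs. length fs = p + 1 \<and> (\<forall>f\<in>set fs. smooth_on U f) \<longrightarrow>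
        smooth_on U (br fs) \<and>
        (\<forall>hs. length hs = p + 1 \<and> (\<forall>h\<in>set hs. smooth_on U h) \<and>
           (\<forall>k<p + 1. \<forall>u\<in>U. (fs ! k) u = (hs ! k) u) \<longrightarrow> (\<forall>u\<in>U. br fs u = br hs u)) \<and>
        (\<forall>k<p + 1. \<forall>f h. smooth_on U f \<and> smooth_on U h \<longrightarrow>
           (\<forall>u\<in>U.
              br (fs[k := (\<lambda>v. f v + h v)]) u = br (fs[k := f]) u + br (fs[k := h]) u \<and>
              (\<forall>c. br (fs[k := (\<lambda>v. c * f v)]) u = c * br (fs[k := f]) u) \<and>
              br (fs[k := (\<lambda>v. f v * h v)]) u
                = f u * br (fs[k := h]) u + h u * br (fs[k := f]) u)))"

definition multi_indices :: "nat \<Rightarrow> 'm list set" where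
  "multi_indices p = {I. length I = p}"

text \<open>\<open>\<eta>\<^sub>I\<^sub>J\<close> for multi-indices of length \<open>p\<close>\<close>
definition multi_metric :: "nat \<Rightarrow> real ^ 'm ^ 'm \<Rightarrow> 'm list \<Rightarrow> 'm list \<Rightarrow> real" where
  "multi_metric p A I J = (\<Prod>k<p. A $ (I ! k) $ (J ! k))"

text \<open>\<open>{f, x\<^sup>I}\<close>\<close>
definition bracket_coords ::
  "((real ^ 'n \<Rightarrow> real) list \<Rightarrow> real ^ 'n \<Rightarrow> real) \<Rightarrow> (real ^ 'n \<Rightarrow> real ^ 'm) \<Rightarrow>
   (real ^ 'n \<Rightarrow> real) \<Rightarrow> 'm list \<Rightarrow> real ^ 'n \<Rightarrow> real" where
  "bracket_coords br x f I = br (f # map (\<lambda>i v. x v $ i) I)"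

definition P_tensor ::
  "nat \<Rightarrow> ((real ^ 'n \<Rightarrow> real) list \<Rightarrow> real ^ 'n \<Rightarrow> real) \<Rightarrow> (real ^ 'n \<Rightarrow> real ^ 'm) \<Rightarrow>
   'm \<Rightarrow> 'm list \<Rightarrow> real ^ 'n \<Rightarrow> real" where
  "P_tensor p br x i I u = 1 / sqrt (fact p) * bracket_coords br x (\<lambda>v. x v $ i) I u"

definition compatible_bracket ::
  "nat \<Rightarrow> (real ^ 'm \<Rightarrow> real ^ 'm ^ 'm) \<Rightarrow> (real ^ 'n) set \<Rightarrow> (real ^ 'n \<Rightarrow> real ^ 'm) \<Rightarrow>
   ((real ^ 'n \<Rightarrow> real) list \<Rightarrow> real ^ 'n \<Rightarrow> real) \<Rightarrow> (real ^ 'n \<Rightarrow> real) \<Rightarrow> real \<Rightarrow> bool" where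
  "compatible_bracket p \<eta> U x br \<gamma> \<epsilon> \<longleftrightarrow>
     smooth_on U \<gamma> \<and> (\<forall>u\<in>U. \<gamma> u > 0) \<and> \<epsilon> \<in> {-1, 1} \<and>
     (\<forall>u\<in>U. \<forall>i j.
        (\<Sum>I\<in>multi_indices p. \<Sum>J\<in>multi_indices p.
           P_tensor p br x i I u * P_tensor p br x j J u * multi_metric p (\<eta> (x u)) I J)
        = \<epsilon> * (\<gamma> u)\<^sup>2 * (\<Sum>a\<in>UNIV. \<Sum>b\<in>UNIV. matrix_inv (induced_metric \<eta> x u) $ a $ b
             * partial a (\<lambda>v. x v $ i) u * partial b (\<lambda>v. x v $ j) u))"

text \<open>Components \<open>B\<^sub>N\<^sup>i\<^sup>j\<close>, by their expression in terms of brackets.  With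
  \<open>D\<^sup>i\<^sup>l = \<epsilon>/\<gamma>\<^sup>2 P\<^sup>i\<^sup>I P\<^sup>l\<^sup>J \<eta>\<^sub>I\<^sub>J\<close> this is what \<open>- D\<^sup>i\<^sup>l \<nabla>\<^sub>l N\<^sup>j\<close> amounts to, for a field \<open>N\<close> that is only
  defined along the submanifold.\<close>
definition B_tensor ::
  "nat \<Rightarrow> (real ^ 'm \<Rightarrow> real ^ 'm ^ 'm) \<Rightarrow> (real ^ 'n \<Rightarrow> real ^ 'm) \<Rightarrow>
   ((real ^ 'n \<Rightarrow> real) list \<Rightarrow> real ^ 'n \<Rightarrow> real) \<Rightarrow> (real ^ 'n \<Rightarrow> real) \<Rightarrow> real \<Rightarrow>
   (real ^ 'n \<Rightarrow> real ^ 'm) \<Rightarrow> 'm \<Rightarrow> 'm \<Rightarrow> real ^ 'n \<Rightarrow> real" where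
  "B_tensor p \<eta> x br \<gamma> \<epsilon> N i j u =
     - \<epsilon> / ((\<gamma> u)\<^sup>2 * fact p) * (\<Sum>I\<in>multi_indices p. \<Sum>J\<in>multi_indices p.
         bracket_coords br x (\<lambda>v. x v $ i) I u * bracket_coords br x (\<lambda>v. N v $ j) J u
         * multi_metric p (\<eta> (x u)) I J)
     - \<epsilon> / ((\<gamma> u)\<^sup>2 * fact p) * (\<Sum>I\<in>multi_indices p. \<Sum>J\<in>multi_indices p.
         \<Sum>k\<in>UNIV. \<Sum>l\<in>UNIV.
         bracket_coords br x (\<lambda>v. x v $ i) I u * bracket_coords br x (\<lambda>v. x v $ k) J u
         * multi_metric p (\<eta> (x u)) I J * christoffel \<eta> (x u) j k l * N u $ l)"

definition B_map ::
  "nat \<Rightarrow> (real ^ 'm \<Rightarrow> real ^ 'm ^ 'm) \<Rightarrow> (real ^ 'n \<Rightarrow> real ^ 'm) \<Rightarrow>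
   ((real ^ 'n \<Rightarrow> real) list \<Rightarrow> real ^ 'n \<Rightarrow> real) \<Rightarrow> (real ^ 'n \<Rightarrow> real) \<Rightarrow> real \<Rightarrow>
   (real ^ 'n \<Rightarrow> real ^ 'm) \<Rightarrow> real ^ 'n \<Rightarrow> real ^ 'm \<Rightarrow> real ^ 'm" where
  "B_map p \<eta> x br \<gamma> \<epsilon> N u X =
     (\<chi> i. \<Sum>j\<in>UNIV. \<Sum>k\<in>UNIV. B_tensor p \<eta> x br \<gamma> \<epsilon> N i j u * \<eta> (x u) $ j $ k * X $ k)"

end

theory Submission
  imports Defs
begin

text \<open>In each argument the bracket is a derivation, hence \<open>{f, x\<^sup>J} = \<partial>\<^sub>b f {u\<^sup>b, x\<^sup>J}\<close>.  As the vectors \<open>e\<^sub>b\<close>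
  are linearly independent, compatibility can be stripped of one factor \<open>\<partial>\<^sub>b x\<^sup>j\<close>, and so the bracket
  expression for \<open>B\<^sub>N\<close> becomes \<open>- g\<^sup>a\<^sup>b e\<^sub>a\<^sup>i (\<nabla>\<^sub>b N)\<^sup>j\<close>.  Thus \<open>B\<^sub>N\<close> takes tangential values and
  \<open>\<eta>(e\<^sub>c, B\<^sub>N Y) = - \<eta>(\<nabla>\<^sub>c N, Y)\<close> for every \<open>Y\<close>.  For normal \<open>Y\<close> this is the second claim; for tangent
  \<open>Y\<close> the first one follows from the symmetry of \<open>\<eta>(e\<^sub>c, \<nabla>\<^sub>b N)\<close> in \<open>b\<close> and \<open>c\<close>.\<close>

section \<open>Calculus of smooth functions\<close>

text \<open>The bracket accepts only functions smooth on all of \<open>U\<close>, and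
  \<open>U\<close> is merely open. To write a derivation at a point as a combination of partial
  derivatives, \<open>f\<close> must therefore be expanded about \<open>u0\<close> with coefficients
  smooth on the whole of \<open>U\<close>. A Taylor expansion near \<open>u0\<close> gives no
  admissible arguments, and the segment from \<open>u0\<close> to \<open>u\<close> may leave
  \<open>U\<close>. This is why smoothness is developed as far as parameter integrals over segments.
  The same expansion also yields the commuting second partials behind the symmetry. Compatibility
  constrains only brackets of the functions \<open>x^i\<close>, whereas the components of
  \<open>N\<close> are functions of the parameter in their own right. Both kinds of bracket are
  therefore written through the same \<open>{u^b, x^J}\<close>, so that what compatibility says
  about these carries over to \<open>N\<close>. Symmetry enters the first claim because, when paired
  with \<open>e_c\<close>, the map \<open>B_N\<close> differentiates \<open>N\<close> along
  \<open>e_c\<close> and pairs the result with \<open>X\<close>, while \<open>W_N\<close>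
  differentiates \<open>N\<close> along \<open>X\<close> and pairs the result with
  \<open>e_c\<close>.\<close>

lemma higher_differentiable_on_SucD:
  "higher_differentiable_on (Suc k) S f \<Longrightarrow> higher_differentiable_on k S f"
proof (induction k arbitrary: f)
  case 0
  then show ?case
    by (auto intro!: continuous_at_imp_continuous_on differentiable_imp_continuous_within)
next
  case (Suc k)
  then show ?case by (metis higher_differentiable_on.simps(2))
qed

lemma higher_differentiable_on_cong:
  assumes "open S" "\<And>u. u \<in> S \<Longrightarrow> f u = g u" "higher_differentiable_on k S f"
  shows "higher_differentiable_on k S g"
  using assms(2,3)
proof (induction k arbitrary: f g)
  case 0
  then show ?case by (metis higher_differentiable_on.simps(1) continuous_on_cong)
next
  case (Suc k)
  have df: "f differentiable (at u)" if "u \<in> S" for u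
    using Suc.prems(2) that by simp
  have "frechet_derivative f (at u) = frechet_derivative g (at u)" if "u \<in> S" for u
    using frechet_derivative_transform_within_open[OF df[OF that] assms(1) that] Suc.prems(1) by blast
  moreover have "g differentiable (at u)" if "u \<in> S" for u
    using df[OF that] has_derivative_transform_within_open[OF _ assms(1) that] Suc.prems(1)
    unfolding differentiable_def by metis
  moreover have "higher_differentiable_on k S (\<lambda>u. frechet_derivative f (at u) v)" for v
    using Suc.prems(2) by simp
  ultimately have "higher_differentiable_on k S (\<lambda>u. frechet_derivative g (at u) v)" for v
    using Suc.IH[of "\<lambda>u. frechet_derivative f (at u) v"] by simp
  then show ?case
    using \<open>\<And>u. u \<in> S \<Longrightarrow> g differentiable (at u)\<close> by simp
qed

text \<open>Differentiation rules produce some derivative \<open>f'\<close> at the points of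
  \<open>S\<close>, whereas the definition speaks of \<open>frechet_derivative\<close>. The two are
  known to agree only on \<open>S\<close>, and openness of \<open>S\<close> lets the higher
  derivatives ignore the rest.\<close>

lemma higher_differentiable_on_SucI:
  assumes "open S" "\<And>u. u \<in> S \<Longrightarrow> (f has_derivative f' u) (at u)"
    and "\<And>v. higher_differentiable_on k S (\<lambda>u. f' u v)"
  shows "higher_differentiable_on (Suc k) S f"
proof -
  have "f' u = frechet_derivative f (at u)" if "u \<in> S" for u
    using assms(2) frechet_derivative_at that by blast
  then have "higher_differentiable_on k S (\<lambda>u. frechet_derivative f (at u) v)" for v
    using higher_differentiable_on_cong[OF assms(1) _ assms(3)[of v]] by simp
  then show ?thesis
    using assms(2) by (auto intro: differentiableI)
qed

lemma higher_differentiable_on_has_derivative: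
  "higher_differentiable_on (Suc k) S f \<Longrightarrow> u \<in> S \<Longrightarrow>
    (f has_derivative frechet_derivative f (at u)) (at u)"
  by (simp flip: frechet_derivative_works)

lemma higher_differentiable_on_const: "open S \<Longrightarrow> higher_differentiable_on k S (\<lambda>u. c)"
  by (induction k arbitrary: c) simp_all

lemma higher_differentiable_on_subset:
  "higher_differentiable_on k S f \<Longrightarrow> T \<subseteq> S \<Longrightarrow> higher_differentiable_on k T f"
  by (induction k arbitrary: f) (auto intro: continuous_on_subset)

lemma higher_differentiable_on_Un:
  "open S \<Longrightarrow> open T \<Longrightarrow> higher_differentiable_on k S f \<Longrightarrow> higher_differentiable_on k T f \<Longrightarrow>
    higher_differentiable_on k (S \<union> T) f"
  by (induction k arbitrary: f) (auto intro: continuous_on_open_Un)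

lemma higher_differentiable_on_bounded_linear:
  assumes "bounded_linear L" "open S" "higher_differentiable_on k S f"
  shows "higher_differentiable_on k S (\<lambda>u. L (f u))"
  using assms(3)
proof (induction k arbitrary: f)
  case 0
  then show ?case
    by (auto intro: bounded_linear.continuous_on[OF assms(1)])
next
  case (Suc k)
  show ?case
  proof (rule higher_differentiable_on_SucI[OF assms(2)])
    show "((\<lambda>u. L (f u)) has_derivative (\<lambda>v. L (frechet_derivative f (at u) v))) (at u)"
      if "u \<in> S" for u
      using bounded_linear.has_derivative[OF assms(1)]
        higher_differentiable_on_has_derivative[OF Suc.prems that] by blast
    show "higher_differentiable_on k S (\<lambda>u. L (frechet_derivative f (at u) v))" for v
      using Suc by simp
  qed
qed

lemma higher_differentiable_on_linear:
  assumes "bounded_linear L" "open S"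
  shows "higher_differentiable_on k S L"
proof (cases k)
  case 0
  then show ?thesis
    using linear_continuous_on[OF assms(1)] by simp
next
  case (Suc k')
  then show ?thesis
    using higher_differentiable_on_SucI[OF assms(2) bounded_linear_imp_has_derivative[OF assms(1)]]
      higher_differentiable_on_const[OF assms(2)] by blast
qed

lemma higher_differentiable_on_add:
  assumes "open S" "higher_differentiable_on k S f" "higher_differentiable_on k S g"
  shows "higher_differentiable_on k S (\<lambda>u. f u + g u)"
  using assms(2,3)
proof (induction k arbitrary: f g)
  case 0
  then show ?case by (auto intro: continuous_on_add)
next
  case (Suc k)
  note D = higher_differentiable_on_has_derivative
  show ?case
    by (rule higher_differentiable_on_SucI[OF assms(1)
          has_derivative_add[OF D[OF Suc.prems(1)] D[OF Suc.prems(2)]]])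
      (use Suc in auto)
qed

text \<open>The product rule keeps an undifferentiated factor in each summand, so the induction
  hypothesis is also applied to \<open>f\<close> and \<open>g\<close> themselves at the lower order.
  The bilinear form covers products of reals and scalar multiples at once.\<close>

lemma higher_differentiable_on_bilinear:
  assumes "bounded_bilinear B" "open S"
    and "higher_differentiable_on k S f" "higher_differentiable_on k S g"
  shows "higher_differentiable_on k S (\<lambda>u. B (f u) (g u))"
  using assms(3,4)
proof (induction k arbitrary: f g)
  case 0
  then show ?case by (auto intro: bounded_bilinear.continuous_on[OF assms(1)])
next
  case (Suc k)
  note D = higher_differentiable_on_has_derivative
  show ?case
    by (rule higher_differentiable_on_SucI[OF assms(2)
          bounded_bilinear.FDERIV[OF assms(1) D[OF Suc.prems(1)] D[OF Suc.prems(2)]]])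
      (use Suc higher_differentiable_on_SucD[OF Suc.prems(1)] higher_differentiable_on_SucD[OF Suc.prems(2)]
        in \<open>auto intro!: higher_differentiable_on_add[OF assms(2)]\<close>)
qed

lemmas higher_differentiable_on_mult = higher_differentiable_on_bilinear[OF bounded_bilinear_mult]

text \<open>The derivative contains \<open>inverse (f u)\<close> again, but one order lower; hence
  the induction runs over \<open>k\<close> for a fixed \<open>f\<close>, and the rest is a
  product.\<close>

lemma higher_differentiable_on_inverse:
  fixes f :: "'a::real_normed_vector \<Rightarrow> real"
  assumes "open S" "higher_differentiable_on k S f" "\<And>u. u \<in> S \<Longrightarrow> f u \<noteq> 0"
  shows "higher_differentiable_on k S (\<lambda>u. inverse (f u))"
  using assms(2)
proof (induction k)
  case 0
  then show ?case using assms(3) by (auto intro: continuous_on_inverse)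
next
  case (Suc k)
  have IH: "higher_differentiable_on k S (\<lambda>u. inverse (f u))"
    using Suc higher_differentiable_on_SucD by blast
  show ?case
  proof (rule higher_differentiable_on_SucI[OF assms(1)])
    show "((\<lambda>u. inverse (f u)) has_derivative
        (\<lambda>v. - (inverse (f u) * frechet_derivative f (at u) v * inverse (f u)))) (at u)"
      if "u \<in> S" for u
      using Deriv.has_derivative_inverse[OF assms(3)[OF that]
          higher_differentiable_on_has_derivative[OF Suc.prems that]] .
    have "higher_differentiable_on k S
        (\<lambda>u. (- 1) * ((inverse (f u) * frechet_derivative f (at u) v) * inverse (f u)))" for v
      using Suc.prems IH
      by (intro higher_differentiable_on_mult higher_differentiable_on_const assms(1)) auto
    then show "higher_differentiable_on k S
        (\<lambda>u. - (inverse (f u) * frechet_derivative f (at u) v * inverse (f u)))" for v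
      by simp
  qed
qed

section \<open>Closure properties of smooth functions\<close>

lemma smooth_on_cong: "open S \<Longrightarrow> (\<And>u. u \<in> S \<Longrightarrow> f u = g u) \<Longrightarrow> smooth_on S f \<Longrightarrow> smooth_on S g"
  unfolding smooth_on_def using higher_differentiable_on_cong by blast

lemma smooth_on_subset: "smooth_on S f \<Longrightarrow> T \<subseteq> S \<Longrightarrow> smooth_on T f"
  unfolding smooth_on_def using higher_differentiable_on_subset by blast

lemma smooth_on_Un: "open S \<Longrightarrow> open T \<Longrightarrow> smooth_on S f \<Longrightarrow> smooth_on T f \<Longrightarrow> smooth_on (S \<union> T) f"
  unfolding smooth_on_def using higher_differentiable_on_Un by blast

lemma smooth_on_const: "open S \<Longrightarrow> smooth_on S (\<lambda>u. c)"
  by (simp add: smooth_on_def higher_differentiable_on_const)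

lemma smooth_on_bounded_linear:
  "bounded_linear L \<Longrightarrow> open S \<Longrightarrow> smooth_on S f \<Longrightarrow> smooth_on S (\<lambda>u. L (f u))"
  by (simp add: smooth_on_def higher_differentiable_on_bounded_linear)

lemma smooth_on_coord: "open S \<Longrightarrow> smooth_on S (\<lambda>u. u $ a)"
  for a :: "'n::finite" and S :: "(real ^ 'n) set"
  by (simp add: smooth_on_def higher_differentiable_on_linear bounded_linear_vec_nth)

lemma smooth_on_add:
  "open S \<Longrightarrow> smooth_on S f \<Longrightarrow> smooth_on S g \<Longrightarrow> smooth_on S (\<lambda>u. f u + g u)"
  by (simp add: smooth_on_def higher_differentiable_on_add)

lemma smooth_on_diff:
  assumes "open S" "smooth_on S f" "smooth_on S g"
  shows "smooth_on S (\<lambda>u. f u - g u)"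
  using smooth_on_add[OF assms(1,2)
      smooth_on_bounded_linear[OF bounded_linear_minus[OF bounded_linear_ident] assms(1,3)]] by simp

lemma smooth_on_sum:
  "open S \<Longrightarrow> (\<And>a. a \<in> A \<Longrightarrow> smooth_on S (f a)) \<Longrightarrow> smooth_on S (\<lambda>u. \<Sum>a\<in>A. f a u)"
  by (induction A rule: infinite_finite_induct) (auto intro: smooth_on_add smooth_on_const)

lemma smooth_on_mult:
  fixes f g :: "'a::real_normed_vector \<Rightarrow> real"
  shows "open S \<Longrightarrow> smooth_on S f \<Longrightarrow> smooth_on S g \<Longrightarrow> smooth_on S (\<lambda>u. f u * g u)"
  by (simp add: smooth_on_def higher_differentiable_on_mult)

lemma smooth_on_scaleR:
  "open S \<Longrightarrow> smooth_on S f \<Longrightarrow> smooth_on S g \<Longrightarrow> smooth_on S (\<lambda>u. f u *\<^sub>R g u)"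
  by (simp add: smooth_on_def higher_differentiable_on_bilinear[OF bounded_bilinear_scaleR])

lemma smooth_on_inverse:
  fixes f :: "'a::real_normed_vector \<Rightarrow> real"
  shows "open S \<Longrightarrow> smooth_on S f \<Longrightarrow> (\<And>u. u \<in> S \<Longrightarrow> f u \<noteq> 0) \<Longrightarrow> smooth_on S (\<lambda>u. inverse (f u))"
  by (simp add: smooth_on_def higher_differentiable_on_inverse)

lemma smooth_on_frechet_derivative:
  "smooth_on S f \<Longrightarrow> smooth_on S (\<lambda>u. frechet_derivative f (at u) v)"
  unfolding smooth_on_def by (metis higher_differentiable_on.simps(2))

lemma smooth_on_partial: "smooth_on S f \<Longrightarrow> smooth_on S (partial a f)"
  using smooth_on_frechet_derivative by (simp add: partial_def[abs_def])

lemma smooth_on_has_derivative: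
  "smooth_on S f \<Longrightarrow> u \<in> S \<Longrightarrow> (f has_derivative frechet_derivative f (at u)) (at u)"
  unfolding smooth_on_def using higher_differentiable_on_has_derivative by blast

lemma smooth_on_imp_continuous_on: "smooth_on S f \<Longrightarrow> continuous_on S f"
  unfolding smooth_on_def by (metis higher_differentiable_on.simps(1))

lemma frechet_derivative_eq_sum_partial:
  fixes f :: "real ^ 'n \<Rightarrow> 'b::real_normed_vector"
  assumes "f differentiable (at u)"
  shows "frechet_derivative f (at u) v = (\<Sum>a\<in>UNIV. v $ a *\<^sub>R partial a f u)"
proof -
  interpret linear "frechet_derivative f (at u)"
    using linear_frechet_derivative[OF assms] .
  have "frechet_derivative f (at u) v = frechet_derivative f (at u) (\<Sum>a\<in>UNIV. v $ a *\<^sub>R axis a 1)"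
    by (simp add: basis_expansion flip: scalar_mult_eq_scaleR)
  then show ?thesis
    by (simp add: sum scaleR partial_def)
qed

lemma smooth_on_has_derivative_partial:
  fixes f :: "real ^ 'n \<Rightarrow> 'b::real_normed_vector"
  assumes "smooth_on S f" "u \<in> S"
  shows "(f has_derivative (\<lambda>v. \<Sum>a\<in>UNIV. v $ a *\<^sub>R partial a f u)) (at u)"
  using smooth_on_has_derivative[OF assms]
    frechet_derivative_eq_sum_partial[OF differentiableI[OF smooth_on_has_derivative[OF assms]]]
  by (metis (no_types, lifting) ext)

lemma partial_eqI: "(f has_derivative f') (at u) \<Longrightarrow> f' (axis a 1) = y \<Longrightarrow> partial a f u = y"
  unfolding partial_def using frechet_derivative_at by metis

section \<open>Integrals along segments as functions of the endpoints\<close>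

text \<open>The fundamental theorem of calculus along the segment from \<open>y\<close> to
  \<open>y + z\<close>. Pulling the components of \<open>z\<close> out of the integral provides the
  linear factors of the Hadamard expansion.\<close>

lemma line_integral_partial:
  fixes f :: "real ^ 'n \<Rightarrow> real"
  assumes "smooth_on T f" "\<And>t. t \<in> {0..1} \<Longrightarrow> y + t *\<^sub>R z \<in> T"
  shows "f (y + z) - f y = (\<Sum>a\<in>UNIV. z $ a * integral {0..1} (\<lambda>t. partial a f (y + t *\<^sub>R z)))"
proof -
  let ?g = "\<lambda>t. y + t *\<^sub>R z"
  have cont: "continuous_on {0..1} (\<lambda>t. partial a f (?g t))" for a
    by (intro continuous_on_compose2[OF smooth_on_imp_continuous_on[OF smooth_on_partial[OF assms(1)]]]
        continuous_intros) (use assms(2) in auto)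
  have "((\<lambda>t. f (?g t)) has_vector_derivative (\<Sum>a\<in>UNIV. z $ a * partial a f (?g t))) (at t within {0..1})"
    if "t \<in> {0..1}" for t
  proof -
    have "(?g has_derivative (\<lambda>s. s *\<^sub>R z)) (at t within {0..1})"
      by (auto intro!: derivative_eq_intros)
    from has_derivative_compose[OF this smooth_on_has_derivative_partial[OF assms(1) assms(2)[OF that]]]
    show ?thesis
      by (simp add: has_vector_derivative_def sum_distrib_left mult_ac)
  qed
  from fundamental_theorem_of_calculus[OF _ this]
  have "((\<lambda>t. \<Sum>a\<in>UNIV. z $ a * partial a f (?g t)) has_integral f (y + z) - f y) {0..1}"
    by simp
  then have "f (y + z) - f y = integral {0..1} (\<lambda>t. \<Sum>a\<in>UNIV. z $ a * partial a f (?g t))"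
    by (simp add: integral_unique)
  also have "\<dots> = (\<Sum>a\<in>UNIV. z $ a * integral {0..1} (\<lambda>t. partial a f (?g t)))"
    by (subst integral_sum) (auto intro!: integrable_continuous_real continuous_intros cont)
  finally show ?thesis .
qed

text \<open>The weight \<open>q\<close> makes this family of integrals closed under differentiation:
  by the chain rule, moving \<open>\<psi>\<close> brings down a factor \<open>t\<close>, which is
  absorbed into the weight, and \<open>f\<close> is replaced by its partial derivatives.\<close>

lemma has_derivative_integral_segment:
  fixes f :: "real ^ 'n \<Rightarrow> real" and \<phi> \<psi> :: "real ^ 'k \<Rightarrow> real ^ 'n"
  assumes "open S" "smooth_on T f" "smooth_on S \<phi>" "smooth_on S \<psi>" "continuous_on {0..1} q"
    and "\<And>u t. u \<in> S \<Longrightarrow> t \<in> {0..1} \<Longrightarrow> \<phi> u + t *\<^sub>R \<psi> u \<in> T"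
    and "u \<in> S"
  shows "((\<lambda>u. integral {0..1} (\<lambda>t. q t * f (\<phi> u + t *\<^sub>R \<psi> u))) has_derivative
    (\<lambda>v. \<Sum>b\<in>UNIV.
        frechet_derivative \<phi> (at u) v $ b * integral {0..1} (\<lambda>t. q t * partial b f (\<phi> u + t *\<^sub>R \<psi> u))
      + frechet_derivative \<psi> (at u) v $ b * integral {0..1} (\<lambda>t. (q t * t) * partial b f (\<phi> u + t *\<^sub>R \<psi> u)))) (at u)"
proof -
  \<comment> \<open>\<open>leibniz_rule\<close> works on a convex set, which \<open>S\<close> need
    not be.\<close>
  obtain r where r: "r > 0" "ball u r \<subseteq> S"
    using assms(1,7) open_contains_ball by blast
  define H where "H = (\<lambda>u t. \<phi> u + t *\<^sub>R \<psi> u)"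
  \<comment> \<open>\<open>G w t\<close> is the gradient of \<open>q t * f (H w t)\<close> with
    respect to \<open>w\<close>. Kept as a vector, it is turned by
    \<open>blinfun_inner_right\<close> into the continuous operator-valued derivative that
    \<open>leibniz_rule\<close> demands.\<close>
  define G where "G = (\<lambda>u t. \<chi> a. q t * (\<Sum>b\<in>UNIV. (partial a \<phi> u $ b + t * partial a \<psi> u $ b) * partial b f (H u t)))"
  have contq: "continuous_on (ball u r \<times> {0..1}) (\<lambda>z. q (snd z))"
    by (rule continuous_on_compose2[OF assms(5) continuous_on_snd[OF continuous_on_id]]) auto
  have cont1: "continuous_on (ball u r \<times> {0..1}) (\<lambda>z. g (fst z))"
    if "smooth_on S g" for g :: "real ^ 'k \<Rightarrow> real ^ 'n"
    by (rule continuous_on_compose2[OF smooth_on_imp_continuous_on[OF that] continuous_on_fst[OF continuous_on_id]])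
      (use r in auto)
  have contH: "continuous_on (ball u r \<times> {0..1}) (\<lambda>z. H (fst z) (snd z))"
    unfolding H_def by (intro continuous_intros cont1 assms(3,4))
  have contf: "continuous_on (ball u r \<times> {0..1}) (\<lambda>z. g (H (fst z) (snd z)))"
    if "smooth_on T g" for g :: "real ^ 'n \<Rightarrow> real"
    by (rule continuous_on_compose2[OF smooth_on_imp_continuous_on[OF that] contH])
      (use r assms(6) H_def in force)
  have contG: "continuous_on (ball u r \<times> {0..1}) (\<lambda>z. G (fst z) (snd z))"
    unfolding G_def
    by (intro continuous_intros contq cont1 contf smooth_on_partial assms(2,3,4))
  have contsl: "continuous_on {0..1} (\<lambda>t. g (H w t))"
    if "smooth_on T g" "w \<in> ball u r" for g :: "real ^ 'n \<Rightarrow> real" and w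
    using continuous_on_compose2[OF contf[OF that(1)]
        continuous_on_Pair[OF continuous_on_const[of _ w] continuous_on_id]] that(2)
    by (simp add: image_subset_iff)
  have contGs: "continuous_on {0..1} (G u)"
    using continuous_on_compose2[OF contG
        continuous_on_Pair[OF continuous_on_const[of _ u] continuous_on_id]] r(1)
    by (simp add: image_subset_iff)
  have deriv: "((\<lambda>w. q t * f (H w t)) has_derivative blinfun_apply (blinfun_inner_right (G w t)))
      (at w within ball u r)" if "w \<in> ball u r" "t \<in> cbox 0 1" for w and t :: real
  proof -
    have wS: "w \<in> S" using that r by auto
    have "((\<lambda>w. H w t) has_derivative
        (\<lambda>v. (\<Sum>a\<in>UNIV. v $ a *\<^sub>R partial a \<phi> w) + t *\<^sub>R (\<Sum>a\<in>UNIV. v $ a *\<^sub>R partial a \<psi> w)))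
        (at w within ball u r)"
      unfolding H_def
      by (intro derivative_intros has_derivative_at_withinI[OF smooth_on_has_derivative_partial[OF _ wS]] assms(3,4))
    moreover have "H w t \<in> T"
      using assms(6) wS that by (simp add: H_def)
    ultimately have "((\<lambda>w. q t * f (H w t)) has_derivative
       (\<lambda>v. q t * (\<Sum>b\<in>UNIV. ((\<Sum>a\<in>UNIV. v $ a *\<^sub>R partial a \<phi> w) + t *\<^sub>R (\<Sum>a\<in>UNIV. v $ a *\<^sub>R partial a \<psi> w)) $ b
           *\<^sub>R partial b f (H w t)))) (at w within ball u r)"
      by (intro has_derivative_mult_right has_derivative_compose[OF _ smooth_on_has_derivative_partial[OF assms(2)]])
    moreover have "q t * (\<Sum>b\<in>UNIV. ((\<Sum>a\<in>UNIV. v $ a *\<^sub>R partial a \<phi> w) + t *\<^sub>R (\<Sum>a\<in>UNIV. v $ a *\<^sub>R partial a \<psi> w)) $ b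
           *\<^sub>R partial b f (H w t)) = G w t \<bullet> v" for v
    proof -
      have "((\<Sum>a\<in>UNIV. v $ a *\<^sub>R partial a \<phi> w) + t *\<^sub>R (\<Sum>a\<in>UNIV. v $ a *\<^sub>R partial a \<psi> w)) $ b
          = (\<Sum>a\<in>UNIV. v $ a * (partial a \<phi> w $ b + t * partial a \<psi> w $ b))" for b
        by (simp add: sum_component sum_distrib_left sum.distrib algebra_simps)
      then have "q t * (\<Sum>b\<in>UNIV. ((\<Sum>a\<in>UNIV. v $ a *\<^sub>R partial a \<phi> w) + t *\<^sub>R (\<Sum>a\<in>UNIV. v $ a *\<^sub>R partial a \<psi> w)) $ b
           *\<^sub>R partial b f (H w t))
         = (\<Sum>b\<in>UNIV. \<Sum>a\<in>UNIV. q t * (v $ a * (partial a \<phi> w $ b + t * partial a \<psi> w $ b) * partial b f (H w t)))"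
        by (simp add: sum_distrib_left sum_distrib_right)
      also have "\<dots> = (\<Sum>a\<in>UNIV. \<Sum>b\<in>UNIV. q t * (v $ a * (partial a \<phi> w $ b + t * partial a \<psi> w $ b) * partial b f (H w t)))"
        by (rule sum.swap)
      also have "\<dots> = G w t \<bullet> v"
        by (simp add: G_def inner_vec_def sum_distrib_left sum_distrib_right mult_ac)
      finally show ?thesis .
    qed
    ultimately show ?thesis
      by (simp add: blinfun_inner_right.rep_eq)
  qed
  have "((\<lambda>w. integral (cbox 0 1) (\<lambda>t. q t * f (H w t))) has_derivative
      integral (cbox 0 1) (\<lambda>t. blinfun_inner_right (G u t))) (at u within ball u r)"
  proof (rule leibniz_rule[OF deriv])
    show "(\<lambda>t. q t * f (H w t)) integrable_on cbox 0 1" if "w \<in> ball u r" for w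
      using assms(5) contsl[OF assms(2) that]
      by (auto intro!: integrable_continuous_real continuous_intros)
    show "continuous_on (ball u r \<times> cbox 0 1) (\<lambda>(w, t). blinfun_inner_right (G w t))"
      using bounded_linear.continuous_on[OF bounded_linear_blinfun_inner_right contG]
      by (simp add: case_prod_unfold)
  qed (use r in auto)
  moreover have "blinfun_apply (integral (cbox 0 1) (\<lambda>t. blinfun_inner_right (G u t))) v
    = (\<Sum>b\<in>UNIV. frechet_derivative \<phi> (at u) v $ b * integral {0..1} (\<lambda>t. q t * partial b f (H u t))
      + frechet_derivative \<psi> (at u) v $ b * integral {0..1} (\<lambda>t. (q t * t) * partial b f (H u t)))" for v
  proof -
    have fr: "frechet_derivative g (at u) v = (\<Sum>a\<in>UNIV. v $ a *\<^sub>R partial a g u)"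
      if "smooth_on S g" for g :: "real ^ 'k \<Rightarrow> real ^ 'n"
      using frechet_derivative_eq_sum_partial[OF differentiableI[OF smooth_on_has_derivative[OF that assms(7)]]] .
    have "blinfun_apply (integral (cbox 0 1) (\<lambda>t. blinfun_inner_right (G u t))) v
       = integral {0..1} (\<lambda>t. G u t \<bullet> v)"
      by (subst blinfun_apply_integral)
        (auto intro!: integrable_continuous_real bounded_linear.continuous_on[OF bounded_linear_blinfun_inner_right] contGs)
    also have "\<dots> = integral {0..1} (\<lambda>t. \<Sum>b\<in>UNIV.
       frechet_derivative \<phi> (at u) v $ b * (q t * partial b f (H u t))
       + frechet_derivative \<psi> (at u) v $ b * ((q t * t) * partial b f (H u t)))"
    proof (rule integral_cong)
      fix t
      have "G u t \<bullet> v = (\<Sum>a\<in>UNIV. \<Sum>b\<in>UNIV. v $ a * partial a \<phi> u $ b * (q t * partial b f (H u t))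
          + v $ a * partial a \<psi> u $ b * ((q t * t) * partial b f (H u t)))"
        by (simp add: G_def inner_vec_def sum_distrib_left sum_distrib_right algebra_simps)
      also have "\<dots> = (\<Sum>b\<in>UNIV. \<Sum>a\<in>UNIV. v $ a * partial a \<phi> u $ b * (q t * partial b f (H u t))
          + v $ a * partial a \<psi> u $ b * ((q t * t) * partial b f (H u t)))"
        by (rule sum.swap)
      finally show "G u t \<bullet> v = (\<Sum>b\<in>UNIV.
           frechet_derivative \<phi> (at u) v $ b * (q t * partial b f (H u t))
           + frechet_derivative \<psi> (at u) v $ b * ((q t * t) * partial b f (H u t)))"
        unfolding fr[OF assms(3)] fr[OF assms(4)]
        by (simp add: sum_component sum.distrib sum_distrib_right)
    qed
    also have "\<dots> = (\<Sum>b\<in>UNIV. frechet_derivative \<phi> (at u) v $ b * integral {0..1} (\<lambda>t. q t * partial b f (H u t))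
      + frechet_derivative \<psi> (at u) v $ b * integral {0..1} (\<lambda>t. (q t * t) * partial b f (H u t)))"
      using contsl[OF smooth_on_partial[OF assms(2)]] r(1) assms(5)
      by (subst integral_sum integral_add integral_mult_right | intro sum.cong refl
          | force intro!: integrable_continuous_real continuous_intros)+
    finally show ?thesis .
  qed
  ultimately show ?thesis
    unfolding H_def using r(1) at_within_open[of u "ball u r"] by (auto intro: has_derivative_eq_rhs)
qed

lemma smooth_on_integral_segment:
  fixes f :: "real ^ 'n \<Rightarrow> real" and \<phi> \<psi> :: "real ^ 'k \<Rightarrow> real ^ 'n"
  assumes "open S" "smooth_on T f" "smooth_on S \<phi>" "smooth_on S \<psi>"
    and "\<And>u t. u \<in> S \<Longrightarrow> t \<in> {0..1} \<Longrightarrow> \<phi> u + t *\<^sub>R \<psi> u \<in> T"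
  shows "smooth_on S (\<lambda>u. integral {0..1} (\<lambda>t. f (\<phi> u + t *\<^sub>R \<psi> u)))"
proof -
  \<comment> \<open>Generalised over \<open>f\<close> and \<open>q\<close>, as the induction step
    passes to the partial derivatives of \<open>f\<close> with weights \<open>q t\<close> and
    \<open>q t * t\<close>; the claim is the case of weight 1.\<close>
  have *: "higher_differentiable_on k S (\<lambda>u. integral {0..1} (\<lambda>t. q t * f (\<phi> u + t *\<^sub>R \<psi> u)))"
    if "smooth_on T f" "continuous_on {0..1} q" for k q and f :: "real ^ 'n \<Rightarrow> real"
    using that
  proof (induction k arbitrary: f q)
    case 0
    show ?case
      using has_derivative_continuous[OF has_derivative_integral_segment[OF assms(1) 0(1) assms(3,4) 0(2) assms(5)]]
      by (auto intro: continuous_at_imp_continuous_on)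
  next
    case (Suc k)
    have fr: "higher_differentiable_on k S (\<lambda>u. frechet_derivative g (at u) v $ b)"
      if "smooth_on S g" for g :: "real ^ 'k \<Rightarrow> real ^ 'n" and v b
      using smooth_on_bounded_linear[OF bounded_linear_vec_nth assms(1) smooth_on_frechet_derivative[OF that]]
      by (simp add: smooth_on_def)
    have sum: "higher_differentiable_on k S (\<lambda>u. \<Sum>b\<in>B. h b u)"
      if "\<And>b. higher_differentiable_on k S (h b)" for B :: "'n set" and h :: "'n \<Rightarrow> real ^ 'k \<Rightarrow> real"
      by (induction B rule: infinite_finite_induct)
        (auto intro: higher_differentiable_on_add higher_differentiable_on_const assms(1) that)
    have qt: "continuous_on {0..1} (\<lambda>t. q t * t)"
      using Suc.prems(2) by (intro continuous_intros)
    show ?case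
      by (rule higher_differentiable_on_SucI[OF assms(1)
            has_derivative_integral_segment[OF assms(1) Suc.prems(1) assms(3,4) Suc.prems(2) assms(5)]])
        (auto intro!: sum higher_differentiable_on_add higher_differentiable_on_mult assms(1)
          fr assms(3,4) Suc.IH smooth_on_partial Suc.prems qt)
  qed
  show ?thesis
    unfolding smooth_on_def using *[OF assms(2) continuous_on_const[of _ 1]] by simp
qed

section \<open>Rules for coordinate partial derivatives\<close>

lemma smooth_on_differentiable: "smooth_on S f \<Longrightarrow> u \<in> S \<Longrightarrow> f differentiable (at u)"
  using smooth_on_has_derivative differentiableI by blast

lemma partial_cong:
  assumes "open S" "u \<in> S" "\<And>v. v \<in> S \<Longrightarrow> f v = g v" "f differentiable (at u)"
  shows "partial a f u = partial a g u"
  unfolding partial_def using frechet_derivative_transform_within_open[OF assms(4,1,2,3)] by simp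

lemma partial_const: "partial a (\<lambda>u. c) u = 0"
  by (simp add: partial_def)

lemma partial_add:
  assumes "f differentiable (at u)" "g differentiable (at u)"
  shows "partial a (\<lambda>u. f u + g u) u = partial a f u + partial a g u"
  by (rule partial_eqI[OF has_derivative_add])
    (use assms in \<open>auto simp: frechet_derivative_works partial_def\<close>)

lemma partial_mult:
  fixes f g :: "real ^ 'n \<Rightarrow> real"
  assumes "f differentiable (at u)" "g differentiable (at u)"
  shows "partial a (\<lambda>u. f u * g u) u = f u * partial a g u + partial a f u * g u"
  by (rule partial_eqI[OF has_derivative_mult])
    (use assms in \<open>auto simp: frechet_derivative_works partial_def\<close>)

lemma partial_sum:
  assumes "\<And>i. i \<in> A \<Longrightarrow> f i differentiable (at u)"
  shows "partial a (\<lambda>u. \<Sum>i\<in>A. f i u) u = (\<Sum>i\<in>A. partial a (f i) u)"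
  by (rule partial_eqI[OF has_derivative_sum])
    (use assms in \<open>auto simp: frechet_derivative_works partial_def\<close>)

lemma partial_vec_nth:
  assumes "f differentiable (at u)"
  shows "partial a (\<lambda>u. f u $ i) u = partial a f u $ i"
  by (rule partial_eqI[OF bounded_linear.has_derivative[OF bounded_linear_vec_nth]])
    (use assms in \<open>auto simp: frechet_derivative_works partial_def\<close>)

lemma partial_coord_diff: "partial b (\<lambda>u :: real ^ 'n. u $ a - c) u = (if a = b then 1 else 0)"
proof (rule partial_eqI)
  show "((\<lambda>u :: real ^ 'n. u $ a - c) has_derivative (\<lambda>v. v $ a)) (at u)"
    by (auto intro!: derivative_eq_intros bounded_linear_imp_has_derivative bounded_linear_vec_nth)
qed (simp add: axis_def)

text \<open>Global on an arbitrary open set, without bump functions: with \<open>r = norm (u - u\<^sub>0)\<close> and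
  \<open>l = 1 / (1 + r\<^sup>2 / R\<^sup>2)\<close>, the point \<open>u\<^sub>0 + l (u - u\<^sub>0)\<close> always lies in the ball of radius \<open>R\<close>, so
  integration along a segment handles \<open>f (u\<^sub>0 + l (u - u\<^sub>0)) - f u\<^sub>0\<close>.  As \<open>1 - l\<close> is divisible by
  \<open>r\<^sup>2\<close>, so is \<open>f u - f (u\<^sub>0 + l (u - u\<^sub>0))\<close> near \<open>u\<^sub>0\<close>, and away from \<open>u\<^sub>0\<close> one may divide by \<open>r\<^sup>2\<close>.\<close>
lemma hadamard_lemma:
  fixes f :: "real ^ 'n \<Rightarrow> real"
  assumes U: "open U" "u0 \<in> U" and f: "smooth_on U f"
  obtains G where "\<And>a. smooth_on U (G a)"
    and "\<And>u. u \<in> U \<Longrightarrow> f u = f u0 + (\<Sum>a\<in>UNIV. (u $ a - u0 $ a) * G a u)"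
proof -
  obtain R where R: "R > 0" "ball u0 R \<subseteq> U"
    using U open_contains_ball by blast
  let ?B = "ball u0 R"
  define \<rho> where "\<rho> = (\<lambda>u. \<Sum>a\<in>UNIV. (u $ a - u0 $ a) * (u $ a - u0 $ a))"
  define l where "l = (\<lambda>u. inverse (1 + inverse (R\<^sup>2) * \<rho> u))"
  have \<rho>_norm: "\<rho> u = (norm (u - u0))\<^sup>2" for u
    by (simp add: \<rho>_def power2_norm_eq_inner inner_vec_def)
  have pos: "1 + inverse (R\<^sup>2) * \<rho> u > 0" for u
    using R by (simp add: \<rho>_norm add_pos_nonneg)
  have l01: "0 < l u" "l u \<le> 1" for u
    using pos[of u] R by (auto simp: l_def \<rho>_norm inverse_le_1_iff)
  have l_eq: "1 - l u = \<rho> u * (l u * inverse (R\<^sup>2))" for u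
    using pos[of u] by (simp add: l_def field_simps)
  have w_smooth: "smooth_on S (\<lambda>u. u $ a - u0 $ a)" if "open S" for S a
    by (intro smooth_on_diff smooth_on_coord smooth_on_const that)
  have \<rho>_smooth: "smooth_on S \<rho>" if "open S" for S
    unfolding \<rho>_def by (intro smooth_on_sum smooth_on_mult w_smooth that)
  have l_smooth: "smooth_on S l" if "open S" for S
    unfolding l_def
  proof (rule smooth_on_inverse[OF that])
    show "smooth_on S (\<lambda>u. 1 + inverse (R\<^sup>2) * \<rho> u)"
      by (intro smooth_on_add smooth_on_mult smooth_on_const \<rho>_smooth that)
    show "1 + inverse (R\<^sup>2) * \<rho> u \<noteq> 0" for u
      using pos[of u] by simp
  qed
  have id_smooth: "smooth_on S (\<lambda>u. u - u0)" if "open S" for S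
    using that by (intro smooth_on_diff smooth_on_const)
      (auto simp: smooth_on_def intro: higher_differentiable_on_linear bounded_linear_ident)
  have lw: "l u * norm (u - u0) < R" for u
  proof -
    \<comment> \<open>With \<open>r = norm (u - u0)\<close>, the claim \<open>l u * r < R\<close>
      amounts to \<open>R * r < R^2 + r^2\<close>, which follows from positivity of
      \<open>(R - r)^2 + R * r\<close>.\<close>
    have "0 < (R - norm (u - u0))\<^sup>2 + R * norm (u - u0)"
    proof (cases "u = u0")
      case False
      then show ?thesis using R by (simp add: add_nonneg_pos)
    qed (use R in simp)
    then have "norm (u - u0) * R < R\<^sup>2 + (norm (u - u0))\<^sup>2"
      using R by (simp add: power2_eq_square algebra_simps)
    then have "R * (norm (u - u0) * R) < R * (R\<^sup>2 + (norm (u - u0))\<^sup>2)"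
      using R by (intro mult_strict_left_mono)
    then have "norm (u - u0) < R * (1 + inverse (R\<^sup>2) * \<rho> u)"
      using R by (simp add: \<rho>_norm field_simps power2_eq_square)
    then show ?thesis
      using pos[of u] by (simp add: l_def field_simps)
  qed
  have in_ball: "u0 + c *\<^sub>R (u - u0) \<in> ?B" if "0 \<le> c" "c * norm (u - u0) < R" for u and c :: real
    using that by (simp add: dist_norm)
  \<comment> \<open>\<open>h\<close> belongs to the segment from \<open>u0\<close> to the shrunken
    point, which stays in the ball for every \<open>u\<close>. \<open>g\<close> belongs to the
    segment from the shrunken point on to \<open>u\<close>, which is known to lie in
    \<open>U\<close> when \<open>u\<close> is in the ball.\<close>
  define h where "h = (\<lambda>a u. integral {0..1} (\<lambda>t. partial a f (u0 + t *\<^sub>R (l u *\<^sub>R (u - u0)))))"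
  define g where "g = (\<lambda>a u. integral {0..1}
    (\<lambda>t. partial a f ((u0 + l u *\<^sub>R (u - u0)) + t *\<^sub>R ((1 - l u) *\<^sub>R (u - u0)))))"
  have h_seg: "u0 + t *\<^sub>R (l u *\<^sub>R (u - u0)) \<in> U" if "t \<in> {0..1}" for t u
  proof -
    have "t * (l u * norm (u - u0)) \<le> 1 * (l u * norm (u - u0))"
      by (rule mult_right_mono) (use that l01[of u] in auto)
    then have "t * l u * norm (u - u0) < R"
      using lw[of u] by (simp only: mult.assoc)
    then have "u0 + (t * l u) *\<^sub>R (u - u0) \<in> ?B"
      using that l01[of u] by (intro in_ball) auto
    then show ?thesis using R by auto
  qed
  have g_seg: "(u0 + l u *\<^sub>R (u - u0)) + t *\<^sub>R ((1 - l u) *\<^sub>R (u - u0)) \<in> U"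
    if "t \<in> {0..1}" "u \<in> ?B" for t u
  proof -
    have "t * (1 - l u) \<le> 1 * (1 - l u)"
      using that l01[of u] by (intro mult_right_mono) auto
    then have "(l u + t * (1 - l u)) * norm (u - u0) \<le> 1 * norm (u - u0)"
      by (intro mult_right_mono) auto
    also have "\<dots> < R" using that by (simp add: dist_norm norm_minus_commute)
    finally have "u0 + (l u + t * (1 - l u)) *\<^sub>R (u - u0) \<in> ?B"
      using that l01[of u] by (intro in_ball) auto
    then show ?thesis using R by (auto simp: algebra_simps)
  qed
  have h_smooth: "smooth_on U (h a)" for a
    unfolding h_def
    by (rule smooth_on_integral_segment[OF U(1) smooth_on_partial[OF f] _ _ h_seg])
      (auto intro!: smooth_on_const smooth_on_scaleR l_smooth id_smooth U)
  have g_smooth: "smooth_on ?B (g a)" for a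
    unfolding g_def
    by (rule smooth_on_integral_segment[OF open_ball smooth_on_partial[OF f] _ _ g_seg])
      (auto intro!: smooth_on_const smooth_on_add smooth_on_diff smooth_on_scaleR l_smooth id_smooth)
  have f_inner: "f (u0 + l u *\<^sub>R (u - u0)) = f u0 + (\<Sum>a\<in>UNIV. (u $ a - u0 $ a) * (l u * h a u))" for u
    using line_integral_partial[OF f h_seg[of _ u]] by (simp add: h_def mult_ac)
  have f_outer: "f u = f (u0 + l u *\<^sub>R (u - u0))
      + \<rho> u * (\<Sum>a\<in>UNIV. (u $ a - u0 $ a) * (l u * inverse (R\<^sup>2) * g a u))" if "u \<in> ?B" for u
  proof -
    have "(u0 + l u *\<^sub>R (u - u0)) + (1 - l u) *\<^sub>R (u - u0) = u"
      by (simp add: algebra_simps)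
    then have "f u - f (u0 + l u *\<^sub>R (u - u0)) = (\<Sum>a\<in>UNIV. ((1 - l u) *\<^sub>R (u - u0)) $ a * g a u)"
      using line_integral_partial[OF f g_seg[OF _ that]] by (simp add: g_def)
    then show ?thesis
      by (simp add: l_eq sum_distrib_left mult_ac)
  qed
  \<comment> \<open>The quotient of \<open>f u - f (u0 + l u *\<^sub>R (u - u0))\<close> by
    \<open>\<rho> u\<close>, given by two formulas: the first makes sense also at \<open>u0\<close>,
    the second outside the ball. They agree on the punctured ball, so \<open>k\<close> is smooth on
    both members of the open cover of \<open>U\<close> by the ball and
    \<open>U - {u0}\<close>.\<close>
  define k where "k = (\<lambda>u. if u \<in> ?B then \<Sum>a\<in>UNIV. (u $ a - u0 $ a) * (l u * inverse (R\<^sup>2) * g a u)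
    else (f u - (f u0 + (\<Sum>a\<in>UNIV. (u $ a - u0 $ a) * (l u * h a u)))) * inverse (\<rho> u))"
  have \<rho>_nz: "\<rho> u \<noteq> 0" if "u \<noteq> u0" for u
    using that by (simp add: \<rho>_norm)
  have f_eq: "f u = f u0 + (\<Sum>a\<in>UNIV. (u $ a - u0 $ a) * (l u * h a u)) + \<rho> u * k u" for u
  proof (cases "u \<in> ?B")
    case True
    then show ?thesis using f_outer[OF True] by (simp add: f_inner k_def)
  next
    case False
    then have "u \<noteq> u0" using R by auto
    then show ?thesis using \<rho>_nz[of u] False by (simp add: k_def mult.left_commute[of "\<rho> u"])
  qed
  have k_smooth: "smooth_on U k"
  proof -
    have "smooth_on ?B k"
      by (rule smooth_on_cong[where f = "\<lambda>u. \<Sum>a\<in>UNIV. (u $ a - u0 $ a) * (l u * inverse (R\<^sup>2) * g a u)"])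
        (auto simp: k_def intro!: smooth_on_sum smooth_on_mult w_smooth l_smooth smooth_on_const g_smooth)
    moreover have "smooth_on (U - {u0}) k"
    proof (rule smooth_on_cong)
      show o: "open (U - {u0})" using U by (simp add: open_delete)
      show "smooth_on (U - {u0}) (\<lambda>u. (f u - (f u0 + (\<Sum>a\<in>UNIV. (u $ a - u0 $ a) * (l u * h a u)))) * inverse (\<rho> u))"
        using \<rho>_nz smooth_on_subset[OF h_smooth, of "U - {u0}"] smooth_on_subset[OF f, of "U - {u0}"]
        by (intro smooth_on_diff smooth_on_add smooth_on_sum smooth_on_mult smooth_on_inverse
            w_smooth l_smooth \<rho>_smooth smooth_on_const o) auto
      show "(f u - (f u0 + (\<Sum>a\<in>UNIV. (u $ a - u0 $ a) * (l u * h a u)))) * inverse (\<rho> u) = k u"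
        if "u \<in> U - {u0}" for u
        using f_eq[of u] \<rho>_nz[of u] that by (simp add: field_simps)
    qed
    moreover have "U = ?B \<union> (U - {u0})" using R U by auto
    ultimately show ?thesis
      using smooth_on_Un[of ?B "U - {u0}" k] U(1) by (simp add: open_delete)
  qed
  show thesis
  proof
    \<comment> \<open>Since \<open>\<rho> u\<close> is the sum of the squares of
      \<open>u $ a - u0 $ a\<close>, the term \<open>\<rho> u * k u\<close> adds
      \<open>(u $ a - u0 $ a) * k u\<close> to the coefficient of index \<open>a\<close>.\<close>
    show "smooth_on U (\<lambda>u. l u * h a u + (u $ a - u0 $ a) * k u)" for a
      by (intro smooth_on_add smooth_on_mult l_smooth h_smooth w_smooth k_smooth U)
    show "f u = f u0 + (\<Sum>a\<in>UNIV. (u $ a - u0 $ a) * (l u * h a u + (u $ a - u0 $ a) * k u))" for u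
      unfolding f_eq[of u] \<rho>_def
      by (simp add: distrib_left sum.distrib sum_distrib_left sum_distrib_right mult_ac)
  qed
qed

section \<open>Hadamard coefficients, second partials and derivations at a point\<close>

text \<open>At \<open>u = u0\<close> the last sum vanishes, so the partial derivatives of a Hadamard
  expansion at its centre read off the coefficients.\<close>

lemma partial_sum_coord_mult:
  fixes G :: "'n \<Rightarrow> real ^ 'n \<Rightarrow> real"
  assumes "\<And>a. smooth_on U (G a)" "open U" "u \<in> U"
  shows "partial b (\<lambda>u. \<Sum>a\<in>UNIV. (u $ a - u0 $ a) * G a u) u
    = G b u + (\<Sum>a\<in>UNIV. (u $ a - u0 $ a) * partial b (G a) u)"
proof -
  have w: "(\<lambda>u. u $ a - u0 $ a) differentiable (at u)" for a
    by (intro smooth_on_differentiable[OF smooth_on_diff[OF open_UNIV]] smooth_on_coord smooth_on_const) auto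
  note G = smooth_on_differentiable[OF assms(1,3)]
  show ?thesis
    by (subst partial_sum) (simp_all add: w G partial_mult partial_coord_diff sum.distrib
        if_distrib[of "\<lambda>r. r * _"] cong: if_cong)
qed

text \<open>Differentiating the Hadamard expansion of \<open>f\<close> about \<open>u0\<close> twice
  gives \<open>partial c (G b) u0 + partial b (G c) u0\<close> at the centre, which is visibly
  symmetric.\<close>

lemma partial_commute:
  fixes f :: "real ^ 'n \<Rightarrow> real"
  assumes U: "open U" "u0 \<in> U" and f: "smooth_on U f"
  shows "partial b (partial c f) u0 = partial c (partial b f) u0"
proof -
  obtain G where G: "\<And>a. smooth_on U (G a)"
    and eq: "\<And>u. u \<in> U \<Longrightarrow> f u = f u0 + (\<Sum>a\<in>UNIV. (u $ a - u0 $ a) * G a u)"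
    using hadamard_lemma[OF assms] by blast
  have S: "smooth_on U (\<lambda>u. \<Sum>a\<in>UNIV. (u $ a - u0 $ a) * F a u)"
    if "\<And>a. smooth_on U (F a)" for F
    by (intro smooth_on_sum smooth_on_mult smooth_on_diff smooth_on_coord smooth_on_const that U)
  have *: "partial b f u = G b u + (\<Sum>a\<in>UNIV. (u $ a - u0 $ a) * partial b (G a) u)"
    if "u \<in> U" for u b
  proof -
    have "partial b f u = partial b (\<lambda>u. f u0 + (\<Sum>a\<in>UNIV. (u $ a - u0 $ a) * G a u)) u"
      using partial_cong[OF U(1) that eq smooth_on_differentiable[OF f that]] .
    also have "\<dots> = partial b (\<lambda>u. \<Sum>a\<in>UNIV. (u $ a - u0 $ a) * G a u) u"
      using partial_add[OF differentiable_const smooth_on_differentiable[OF S[OF G] that]]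
      by (simp add: partial_const)
    finally show ?thesis
      by (simp add: partial_sum_coord_mult[OF G U(1) that])
  qed
  have "partial c (partial b f) u0 = partial c (G b) u0 + partial b (G c) u0" for b c
  proof -
    note PG = smooth_on_partial[OF G]
    have "partial c (partial b f) u0
        = partial c (\<lambda>u. G b u + (\<Sum>a\<in>UNIV. (u $ a - u0 $ a) * partial b (G a) u)) u0"
      using partial_cong[OF U * smooth_on_differentiable[OF smooth_on_partial[OF f] U(2)]] .
    then show ?thesis
      by (simp add: partial_add[OF smooth_on_differentiable[OF G U(2)] smooth_on_differentiable[OF S[OF PG] U(2)]]
          partial_sum_coord_mult[OF PG U])
  qed
  then show ?thesis by (simp add: add.commute)
qed

text \<open>In the expansion of \<open>f\<close> about \<open>u0\<close> the constant contributes
  nothing, and each product \<open>(u $ a - u0 $ a) * G a u\<close> contributes only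
  \<open>G a u0 * D (\<lambda>u. u $ a)\<close>, because its first factor vanishes at
  \<open>u0\<close>. The number \<open>G a u0\<close> is the partial derivative of \<open>f\<close>.
  The intended \<open>D\<close> is the bracket as a function of one slot, evaluated at a
  point.\<close>

lemma derivation_eq_sum_partial:
  fixes D :: "(real ^ 'n \<Rightarrow> real) \<Rightarrow> real"
  assumes U: "open U" "u0 \<in> U" and f: "smooth_on U f"
    and cong: "\<And>g h. smooth_on U g \<Longrightarrow> smooth_on U h \<Longrightarrow> (\<And>u. u \<in> U \<Longrightarrow> g u = h u) \<Longrightarrow> D g = D h"
    and add: "\<And>g h. smooth_on U g \<Longrightarrow> smooth_on U h \<Longrightarrow> D (\<lambda>u. g u + h u) = D g + D h"
    and scale: "\<And>c g. smooth_on U g \<Longrightarrow> D (\<lambda>u. c * g u) = c * D g"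
    and leibniz: "\<And>g h. smooth_on U g \<Longrightarrow> smooth_on U h \<Longrightarrow>
      D (\<lambda>u. g u * h u) = g u0 * D h + h u0 * D g"
  shows "D f = (\<Sum>a\<in>UNIV. partial a f u0 * D (\<lambda>u. u $ a))"
proof -
  obtain G where G: "\<And>a. smooth_on U (G a)"
    and eq: "\<And>u. u \<in> U \<Longrightarrow> f u = f u0 + (\<Sum>a\<in>UNIV. (u $ a - u0 $ a) * G a u)"
    using hadamard_lemma[OF U f] by blast
  note const = smooth_on_const[OF U(1)] and coord = smooth_on_coord[OF U(1)]
  have w: "smooth_on U (\<lambda>u. u $ a - u0 $ a)" for a
    by (intro smooth_on_diff coord const U)
  \<comment> \<open>The Leibniz rule for \<open>1 = 1 * 1\<close> gives
    \<open>D 1 = 2 * D 1\<close>.\<close>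
  have D_const: "D (\<lambda>u. c) = 0" for c
    using leibniz[OF const[of 1] const[of 1]] scale[OF const[of 1], of c] by simp
  have D_w: "D (\<lambda>u. u $ a - u0 $ a) = D (\<lambda>u. u $ a)" for a
    using add[OF coord const[of "- (u0 $ a)"]] D_const by simp
  have D_sum: "D (\<lambda>u. \<Sum>a\<in>A. h a u) = (\<Sum>a\<in>A. D (h a))" if "\<And>a. smooth_on U (h a)"
    for A and h :: "'n \<Rightarrow> real ^ 'n \<Rightarrow> real"
    by (induction A rule: infinite_finite_induct)
      (simp_all add: D_const add that smooth_on_sum U)
  have S: "smooth_on U (\<lambda>u. \<Sum>a\<in>UNIV. (u $ a - u0 $ a) * G a u)"
    by (intro smooth_on_sum smooth_on_mult w G U)
  have "D f = D (\<lambda>u. f u0 + (\<Sum>a\<in>UNIV. (u $ a - u0 $ a) * G a u))"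
    using cong[OF f _ eq] S by (simp add: smooth_on_add const U)
  also have "\<dots> = (\<Sum>a\<in>UNIV. D (\<lambda>u. (u $ a - u0 $ a) * G a u))"
    by (simp add: add const S D_const D_sum smooth_on_mult w G U)
  also have "\<dots> = (\<Sum>a\<in>UNIV. G a u0 * D (\<lambda>u. u $ a))"
    by (simp add: leibniz w G D_w)
  finally have "D f = (\<Sum>a\<in>UNIV. G a u0 * D (\<lambda>u. u $ a))" .
  moreover have "partial a f u0 = G a u0" for a
  proof -
    have "partial a f u0 = partial a (\<lambda>u. f u0 + (\<Sum>a\<in>UNIV. (u $ a - u0 $ a) * G a u)) u0"
      using partial_cong[OF U eq smooth_on_differentiable[OF f U(2)]] .
    then show ?thesis
      using partial_add[OF differentiable_const smooth_on_differentiable[OF S U(2)]]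
      by (simp add: partial_const partial_sum_coord_mult[OF G U])
  qed
  ultimately show ?thesis by simp
qed

section \<open>Geometry of the submanifold\<close>

lemma matrix_inv_right:
  assumes "invertible (A :: real ^ 'n ^ 'n)"
  shows "A ** matrix_inv A = mat 1"
  using someI_ex[OF assms[unfolded invertible_def]] unfolding matrix_inv_def by simp

lemma sum_matrix_inv_right:
  assumes "invertible (A :: real ^ 'n ^ 'n)"
  shows "(\<Sum>k\<in>UNIV. A $ i $ k * matrix_inv A $ k $ j) = (if i = j then 1 else 0)"
  using matrix_inv_right[OF assms] by (simp add: matrix_matrix_mult_def mat_def vec_eq_iff)

lemma sum_delta_mult:
  fixes c :: "'n::finite \<Rightarrow> real"
  shows "(\<Sum>m\<in>UNIV. (if i = m then 1 else 0) * c m) = c i"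
proof -
  have "(if i = m then 1 else 0) * c m = (if i = m then c m else 0)" for m by simp
  then show ?thesis by simp
qed

lemma form_add_right: "form A X (Y + Z) = form A X Y + form A X Z"
  by (simp add: form_def algebra_simps sum.distrib)

lemma form_add_left: "form A (X + Y) Z = form A X Z + form A Y Z"
  by (simp add: form_def algebra_simps sum.distrib)

lemma form_commute: "transpose A = A \<Longrightarrow> form A X Y = form A Y X"
  using form_transpose[of A X Y] by simp

lemma metric_entry_commute:
  assumes "pseudo_riemannian_metric M \<eta>" "p \<in> M"
  shows "\<eta> p $ i $ j = \<eta> p $ j $ i"
proof -
  have "\<eta> p $ i $ j = transpose (\<eta> p) $ j $ i" by (simp add: transpose_def)
  then show ?thesis using assms by (simp add: pseudo_riemannian_metric_def)
qed

lemma metric_entry_smooth: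
  assumes "pseudo_riemannian_metric M \<eta>"
  shows "smooth_on M (\<lambda>p. \<eta> p $ i $ j)"
  using assms unfolding pseudo_riemannian_metric_def
  by (intro smooth_on_bounded_linear[OF bounded_linear_vec_nth]) auto

lemma metric_partial_commute:
  assumes "pseudo_riemannian_metric M \<eta>" "p \<in> M"
  shows "partial l (\<lambda>q. \<eta> q $ i $ j) p = partial l (\<lambda>q. \<eta> q $ j $ i) p"
  by (rule partial_cong[where S = M])
    (use assms metric_entry_commute[OF assms(1)] smooth_on_differentiable[OF metric_entry_smooth[OF assms(1)]]
      in \<open>auto simp: pseudo_riemannian_metric_def\<close>)

text \<open>The Christoffel symbols of the first kind. Lowering the index removes the inverse metric
  and leaves derivatives of \<open>\<eta>\<close> that can be compared with those coming from the
  product rule.\<close>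

lemma christoffel_lowered:
  assumes "pseudo_riemannian_metric M \<eta>" "p \<in> M"
  shows "(\<Sum>m\<in>UNIV. \<eta> p $ i $ m * christoffel \<eta> p m j k)
    = (1/2) * (partial j (\<lambda>q. \<eta> q $ i $ k) p + partial k (\<lambda>q. \<eta> q $ i $ j) p
        - partial i (\<lambda>q. \<eta> q $ j $ k) p)"
proof -
  define T where "T = (\<lambda>l. partial j (\<lambda>q. \<eta> q $ l $ k) p + partial k (\<lambda>q. \<eta> q $ l $ j) p
        - partial l (\<lambda>q. \<eta> q $ j $ k) p)"
  have inv: "invertible (\<eta> p)" using assms by (simp add: pseudo_riemannian_metric_def)
  have "christoffel \<eta> p m j k = (1/2) * (\<Sum>l\<in>UNIV. matrix_inv (\<eta> p) $ m $ l * T l)" for m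
    by (simp add: christoffel_def T_def)
  then have "(\<Sum>m\<in>UNIV. \<eta> p $ i $ m * christoffel \<eta> p m j k)
      = (\<Sum>m\<in>UNIV. \<Sum>l\<in>UNIV. (1/2) * (\<eta> p $ i $ m * matrix_inv (\<eta> p) $ m $ l * T l))"
    by (simp add: sum_distrib_left mult_ac)
  also have "\<dots> = (\<Sum>l\<in>UNIV. \<Sum>m\<in>UNIV. (1/2) * (\<eta> p $ i $ m * matrix_inv (\<eta> p) $ m $ l * T l))"
    by (rule sum.swap)
  also have "\<dots> = (1/2) * (\<Sum>l\<in>UNIV. (\<Sum>m\<in>UNIV. \<eta> p $ i $ m * matrix_inv (\<eta> p) $ m $ l) * T l)"
    by (simp add: sum_distrib_left sum_distrib_right mult_ac)
  also have "\<dots> = (1/2) * T i"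
    by (simp add: sum_matrix_inv_right[OF inv] sum_delta_mult)
  finally show ?thesis by (simp add: T_def)
qed

text \<open>The covariant derivative along the basis vector \<open>e_b\<close>. It avoids the
  definite description inside \<open>tangent_coords\<close>, so that index computations apply;
  \<open>nabla_bar_tangent\<close> is the bridge to \<open>nabla_bar\<close>.\<close>

definition nabla_coord ::
  "(real ^ 'm \<Rightarrow> real ^ 'm ^ 'm) \<Rightarrow> (real ^ 'n \<Rightarrow> real ^ 'm) \<Rightarrow>
   (real ^ 'n \<Rightarrow> real ^ 'm) \<Rightarrow> real ^ 'n \<Rightarrow> 'n \<Rightarrow> real ^ 'm" where
  "nabla_coord \<eta> x Y u b = (\<chi> i. partial b Y u $ i
     + (\<Sum>j\<in>UNIV. \<Sum>k\<in>UNIV. christoffel \<eta> (x u) i j k * partial b x u $ j * Y u $ k))"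

lemma nabla_bar_tangent:
  assumes "invertible (induced_metric \<eta> x u)" "Y differentiable (at u)"
  shows "nabla_bar \<eta> x Y u (\<Sum>b\<in>UNIV. t $ b *\<^sub>R partial b x u) = (\<Sum>b\<in>UNIV. t $ b *\<^sub>R nabla_coord \<eta> x Y u b)"
proof -
  let ?X = "\<Sum>b\<in>UNIV. t $ b *\<^sub>R partial b x u"
  have "?X \<in> tangent_space x u" by (auto simp: tangent_space_iff)
  from tangent_coords_unique[OF assms(1) this] have tc: "tangent_coords x u ?X = t"
    unfolding tangent_coords_def by (intro the1_equality) auto
  have "(\<Sum>j\<in>UNIV. \<Sum>k\<in>UNIV. christoffel \<eta> (x u) i j k * ?X $ j * Y u $ k)
     = (\<Sum>b\<in>UNIV. t $ b * (\<Sum>j\<in>UNIV. \<Sum>k\<in>UNIV. christoffel \<eta> (x u) i j k * partial b x u $ j * Y u $ k))" for i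
  proof -
    have "(\<Sum>j\<in>UNIV. \<Sum>k\<in>UNIV. christoffel \<eta> (x u) i j k * ?X $ j * Y u $ k)
     = (\<Sum>j\<in>UNIV. \<Sum>k\<in>UNIV. \<Sum>b\<in>UNIV. t $ b * (christoffel \<eta> (x u) i j k * partial b x u $ j * Y u $ k))"
      by (simp add: sum_distrib_left sum_distrib_right mult_ac)
    also have "\<dots> = (\<Sum>j\<in>UNIV. \<Sum>b\<in>UNIV. \<Sum>k\<in>UNIV. t $ b * (christoffel \<eta> (x u) i j k * partial b x u $ j * Y u $ k))"
      by (intro sum.cong refl sum.swap)
    also have "\<dots> = (\<Sum>b\<in>UNIV. \<Sum>j\<in>UNIV. \<Sum>k\<in>UNIV. t $ b * (christoffel \<eta> (x u) i j k * partial b x u $ j * Y u $ k))"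
      by (rule sum.swap)
    finally show ?thesis by (simp add: sum_distrib_left)
  qed
  then have "nabla_bar \<eta> x Y u ?X $ i = (\<Sum>b\<in>UNIV. t $ b * partial b Y u $ i)
      + (\<Sum>b\<in>UNIV. t $ b * (\<Sum>j\<in>UNIV. \<Sum>k\<in>UNIV. christoffel \<eta> (x u) i j k * partial b x u $ j * Y u $ k))" for i
    by (simp only: nabla_bar_def tc vec_lambda_beta partial_vec_nth[OF assms(2)])
  then show ?thesis
    by (simp add: vec_eq_iff nabla_coord_def distrib_left sum.distrib)
qed

text \<open>Differentiating \<open>\<eta>(e\<^sub>c, N) = 0\<close> along \<open>e\<^sub>b\<close> eliminates the derivative of \<open>N\<close>; what remains is
  \<open>\<partial>\<^sub>b \<partial>\<^sub>c x\<close> paired with \<open>N\<close> and a combination of derivatives of \<open>\<eta>\<close> that is symmetric in \<open>e\<^sub>b\<close>, \<open>e\<^sub>c\<close>.\<close>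
lemma second_fundamental_form_commute:
  fixes x :: "real ^ 'n \<Rightarrow> real ^ 'm"
  assumes M: "pseudo_riemannian_metric M \<eta>" and x: "nondegenerate_submanifold M \<eta> U x"
    and N: "smooth_on U N" "\<And>u. u \<in> U \<Longrightarrow> N u \<in> normal_complement \<eta> x u" and u: "u \<in> U"
  shows "form (\<eta> (x u)) (partial c x u) (nabla_coord \<eta> x N u b)
    = form (\<eta> (x u)) (partial b x u) (nabla_coord \<eta> x N u c)"
proof -
  have U: "open U" and xs: "smooth_on U x" and xM: "x v \<in> M" if "v \<in> U" for v
    using x that u by (auto simp: nondegenerate_submanifold_def)
  note U = U[OF u] and xs = xs[OF u]
  let ?E = "\<lambda>a. partial a x u"
  define d where "d = (\<lambda>l i j. partial l (\<lambda>q. \<eta> q $ i $ j) (x u))"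
  have dsym: "d l i j = d l j i" for l i j
    unfolding d_def using metric_partial_commute[OF M xM[OF u]] .
  have xi: "smooth_on U (\<lambda>v. x v $ i)" for i
    by (rule smooth_on_bounded_linear[OF bounded_linear_vec_nth U xs])
  have Es: "smooth_on U (\<lambda>v. partial a x v $ i)" for a i
    by (rule smooth_on_bounded_linear[OF bounded_linear_vec_nth U smooth_on_partial[OF xs]])
  have Ns: "smooth_on U (\<lambda>v. N v $ i)" for i
    by (rule smooth_on_bounded_linear[OF bounded_linear_vec_nth U N(1)])
  have eta_deriv: "((\<lambda>v. \<eta> (x v) $ i $ j) has_derivative
      (\<lambda>w. \<Sum>l\<in>UNIV. (\<Sum>a\<in>UNIV. w $ a *\<^sub>R partial a x u) $ l *\<^sub>R d l i j)) (at u)" for i j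
    unfolding d_def
    by (rule has_derivative_compose[OF smooth_on_has_derivative_partial[OF xs u]
          smooth_on_has_derivative_partial[OF metric_entry_smooth[OF M] xM[OF u]]])
  have axis_sum: "(\<Sum>a\<in>UNIV. (axis b 1 :: real ^ 'n) $ a *\<^sub>R partial a x u) = partial b x u" for b
    by (simp add: axis_def if_distrib[of "\<lambda>r. r *\<^sub>R _"] cong: if_cong)
  have eta_partial: "partial b (\<lambda>v. \<eta> (x v) $ i $ j) u = (\<Sum>l\<in>UNIV. ?E b $ l * d l i j)" for i j b
    by (rule partial_eqI[OF eta_deriv]) (simp only: axis_sum real_scaleR_def)
  have second: "partial b (\<lambda>v. partial c x v $ i) u = partial c (\<lambda>v. partial b x v $ i) u" for b c i
  proof -
    have "partial b (\<lambda>v. partial c x v $ i) u = partial b (partial c (\<lambda>v. x v $ i)) u" for b c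
      by (rule partial_cong[OF U u _ smooth_on_differentiable[OF Es u]])
        (simp add: partial_vec_nth[OF smooth_on_differentiable[OF xs]])
    then show ?thesis using partial_commute[OF U u xi] by simp
  qed
  have product_rule: "(\<Sum>i\<in>UNIV. \<Sum>j\<in>UNIV. \<eta> (x u) $ i $ j * ?E c $ i * partial b N u $ j)
    = - (\<Sum>i\<in>UNIV. \<Sum>j\<in>UNIV. (\<Sum>l\<in>UNIV. ?E b $ l * d l i j) * ?E c $ i * N u $ j)
      - (\<Sum>i\<in>UNIV. \<Sum>j\<in>UNIV. \<eta> (x u) $ i $ j * partial b (\<lambda>v. partial c x v $ i) u * N u $ j)" for b c
  proof -
    note D = differentiableI[OF eta_deriv] smooth_on_differentiable[OF Es u] smooth_on_differentiable[OF Ns u]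
    have "partial b (\<lambda>v. form (\<eta> (x v)) (partial c x v) (N v)) u = partial b (\<lambda>v. 0 :: real) u"
    proof (rule partial_cong[OF U u])
      show "form (\<eta> (x v)) (partial c x v) (N v) = 0" if "v \<in> U" for v
        using N(2)[OF that] by (simp add: normal_complement_iff)
      show "(\<lambda>v. form (\<eta> (x v)) (partial c x v) (N v)) differentiable (at u)"
        unfolding form_def by (intro differentiable_sum differentiable_mult D ballI finite)
    qed
    then have "(\<Sum>i\<in>UNIV. \<Sum>j\<in>UNIV. partial b (\<lambda>v. \<eta> (x v) $ i $ j * partial c x v $ i * N v $ j) u) = 0"
      unfolding form_def
      by (simp add: partial_sum differentiable_sum differentiable_mult D partial_const)
    moreover have "partial b (\<lambda>v. \<eta> (x v) $ i $ j * partial c x v $ i * N v $ j) u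
      = \<eta> (x u) $ i $ j * ?E c $ i * partial b N u $ j
        + ((\<Sum>l\<in>UNIV. ?E b $ l * d l i j) * ?E c $ i * N u $ j
        + \<eta> (x u) $ i $ j * partial b (\<lambda>v. partial c x v $ i) u * N u $ j)" for i j
      by (simp add: partial_mult D differentiable_mult eta_partial
          partial_vec_nth[OF smooth_on_differentiable[OF N(1) u]] algebra_simps)
    ultimately show ?thesis by (simp add: sum.distrib)
  qed
  have gamma: "(\<Sum>i\<in>UNIV. \<Sum>m\<in>UNIV. \<eta> (x u) $ i $ m * ?E c $ i *
        (\<Sum>j\<in>UNIV. \<Sum>k\<in>UNIV. christoffel \<eta> (x u) m j k * ?E b $ j * N u $ k))
     = (\<Sum>i\<in>UNIV. \<Sum>j\<in>UNIV. \<Sum>k\<in>UNIV. (1/2) * (d j i k + d k i j - d i j k) * ?E c $ i * ?E b $ j * N u $ k)" for b c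
  proof -
    have "(\<Sum>m\<in>UNIV. \<eta> (x u) $ i $ m * ?E c $ i *
        (\<Sum>j\<in>UNIV. \<Sum>k\<in>UNIV. christoffel \<eta> (x u) m j k * ?E b $ j * N u $ k))
      = (\<Sum>j\<in>UNIV. \<Sum>k\<in>UNIV. (1/2) * (d j i k + d k i j - d i j k) * ?E c $ i * ?E b $ j * N u $ k)" (is "?l = ?r") for i
    proof -
      have "?l = (\<Sum>m\<in>UNIV. \<Sum>j\<in>UNIV. \<Sum>k\<in>UNIV. \<eta> (x u) $ i $ m * christoffel \<eta> (x u) m j k * ?E c $ i * ?E b $ j * N u $ k)"
        by (simp add: sum_distrib_left mult_ac)
      also have "\<dots> = (\<Sum>j\<in>UNIV. \<Sum>m\<in>UNIV. \<Sum>k\<in>UNIV. \<eta> (x u) $ i $ m * christoffel \<eta> (x u) m j k * ?E c $ i * ?E b $ j * N u $ k)"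
        by (rule sum.swap)
      also have "\<dots> = (\<Sum>j\<in>UNIV. \<Sum>k\<in>UNIV. \<Sum>m\<in>UNIV. \<eta> (x u) $ i $ m * christoffel \<eta> (x u) m j k * ?E c $ i * ?E b $ j * N u $ k)"
        by (intro sum.cong refl sum.swap)
      also have "\<dots> = (\<Sum>j\<in>UNIV. \<Sum>k\<in>UNIV. (\<Sum>m\<in>UNIV. \<eta> (x u) $ i $ m * christoffel \<eta> (x u) m j k) * ?E c $ i * ?E b $ j * N u $ k)"
        by (simp add: sum_distrib_right)
      finally show ?thesis
        unfolding christoffel_lowered[OF M xM[OF u]] by (simp add: d_def)
    qed
    then show ?thesis by simp
  qed
  have "form (\<eta> (x u)) (?E c) (nabla_coord \<eta> x N u b)
    = (\<Sum>i\<in>UNIV. \<Sum>j\<in>UNIV. \<Sum>k\<in>UNIV. (1/2) * (d k i j - d j i k - d i j k) * ?E c $ i * ?E b $ j * N u $ k)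
      - (\<Sum>i\<in>UNIV. \<Sum>j\<in>UNIV. \<eta> (x u) $ i $ j * partial b (\<lambda>v. partial c x v $ i) u * N u $ j)" for b c
  proof -
    have "(\<Sum>i\<in>UNIV. \<Sum>k\<in>UNIV. (\<Sum>j\<in>UNIV. ?E b $ j * d j i k) * ?E c $ i * N u $ k)
      = (\<Sum>i\<in>UNIV. \<Sum>k\<in>UNIV. \<Sum>j\<in>UNIV. d j i k * ?E c $ i * ?E b $ j * N u $ k)"
      by (simp add: sum_distrib_left sum_distrib_right mult_ac)
    also have "\<dots> = (\<Sum>i\<in>UNIV. \<Sum>j\<in>UNIV. \<Sum>k\<in>UNIV. d j i k * ?E c $ i * ?E b $ j * N u $ k)"
      by (intro sum.cong refl sum.swap)
    finally have 1: "(\<Sum>i\<in>UNIV. \<Sum>k\<in>UNIV. (\<Sum>j\<in>UNIV. ?E b $ j * d j i k) * ?E c $ i * N u $ k)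
      = (\<Sum>i\<in>UNIV. \<Sum>j\<in>UNIV. \<Sum>k\<in>UNIV. d j i k * ?E c $ i * ?E b $ j * N u $ k)" .
    have "form (\<eta> (x u)) (?E c) (nabla_coord \<eta> x N u b)
      = (\<Sum>i\<in>UNIV. \<Sum>j\<in>UNIV. \<eta> (x u) $ i $ j * ?E c $ i * partial b N u $ j)
        + (\<Sum>i\<in>UNIV. \<Sum>m\<in>UNIV. \<eta> (x u) $ i $ m * ?E c $ i *
        (\<Sum>j\<in>UNIV. \<Sum>k\<in>UNIV. christoffel \<eta> (x u) m j k * ?E b $ j * N u $ k))"
      by (simp add: form_def nabla_coord_def distrib_left sum.distrib)
    also have "\<dots> = (\<Sum>i\<in>UNIV. \<Sum>j\<in>UNIV. \<Sum>k\<in>UNIV. (1/2) * (d j i k + d k i j - d i j k) * ?E c $ i * ?E b $ j * N u $ k)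
      - (\<Sum>i\<in>UNIV. \<Sum>j\<in>UNIV. \<Sum>k\<in>UNIV. d j i k * ?E c $ i * ?E b $ j * N u $ k)
      - (\<Sum>i\<in>UNIV. \<Sum>j\<in>UNIV. \<eta> (x u) $ i $ j * partial b (\<lambda>v. partial c x v $ i) u * N u $ j)"
      unfolding product_rule gamma 1 by simp
    \<comment> \<open>Here \<open>d l i j\<close> is the derivative of
      \<open>\<eta> q $ i $ j\<close> in direction \<open>l\<close>. The product rule contributes
      \<open>- d j i k\<close>, which reverses the sign of the half of \<open>d j i k\<close> in the
      Christoffel term.\<close>
    also have "(\<Sum>i\<in>UNIV. \<Sum>j\<in>UNIV. \<Sum>k\<in>UNIV. (1/2) * (d j i k + d k i j - d i j k) * ?E c $ i * ?E b $ j * N u $ k)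
      - (\<Sum>i\<in>UNIV. \<Sum>j\<in>UNIV. \<Sum>k\<in>UNIV. d j i k * ?E c $ i * ?E b $ j * N u $ k)
      = (\<Sum>i\<in>UNIV. \<Sum>j\<in>UNIV. \<Sum>k\<in>UNIV. (1/2) * (d k i j - d j i k - d i j k) * ?E c $ i * ?E b $ j * N u $ k)"
      unfolding sum_subtractf[symmetric] by (intro sum.cong refl) (simp add: field_simps)
    finally show ?thesis .
  qed
  \<comment> \<open>Renaming exchanges \<open>i\<close> and \<open>j\<close>: this swaps
    \<open>d j i k\<close> with \<open>d i j k\<close>, and \<open>d k i j\<close> is unchanged
    because \<open>\<eta>\<close> is symmetric.\<close>
  moreover have "(\<Sum>i\<in>UNIV. \<Sum>j\<in>UNIV. \<Sum>k\<in>UNIV. (1/2) * (d k i j - d j i k - d i j k) * ?E c $ i * ?E b $ j * N u $ k)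
    = (\<Sum>i\<in>UNIV. \<Sum>j\<in>UNIV. \<Sum>k\<in>UNIV. (1/2) * (d k i j - d j i k - d i j k) * ?E b $ i * ?E c $ j * N u $ k)"
    by (subst sum.swap, intro sum.cong refl) (simp add: dsym algebra_simps)
  ultimately show ?thesis
    by (simp only: second[of b c])
qed

section \<open>The bracket as a tangential derivation\<close>

lemma bracket_coords_chain:
  assumes U: "open U" "u \<in> U" and br: "leibniz_bracket p U br" and x: "smooth_on U x"
    and J: "length J = p" and f: "smooth_on U f"
  shows "bracket_coords br x f J u = (\<Sum>b\<in>UNIV. partial b f u * bracket_coords br x (\<lambda>v. v $ b) J u)"
proof -
  let ?gs = "map (\<lambda>i v. x v $ i) J"
  have gs: "smooth_on U g" if "g \<in> set ?gs" for g
    using that smooth_on_bounded_linear[OF bounded_linear_vec_nth U(1) x] by auto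
  have len: "length (g # ?gs) = p + 1" for g using J by simp
  have congr: "br fs u = br hs u"
    if "length fs = p + 1" "\<forall>f\<in>set fs. smooth_on U f" "length hs = p + 1" "\<forall>h\<in>set hs. smooth_on U h"
      "\<forall>k<p + 1. \<forall>u\<in>U. (fs ! k) u = (hs ! k) u" for fs hs
    using br[unfolded leibniz_bracket_def] that U(2) by blast
  \<comment> \<open>\<open>leibniz_bracket\<close> speaks of updating a slot of a full list of
    smooth functions, so slot 0 has to hold some smooth placeholder \<open>g\<close>, which every
    update overwrites.\<close>
  have first: "br ((g # ?gs)[0 := (\<lambda>v. f v + h v)]) u = br ((g # ?gs)[0 := f]) u + br ((g # ?gs)[0 := h]) u \<and>
      (\<forall>c. br ((g # ?gs)[0 := (\<lambda>v. c * f v)]) u = c * br ((g # ?gs)[0 := f]) u) \<and>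
      br ((g # ?gs)[0 := (\<lambda>v. f v * h v)]) u = f u * br ((g # ?gs)[0 := h]) u + h u * br ((g # ?gs)[0 := f]) u"
    if "smooth_on U g" "smooth_on U f" "smooth_on U h" for f g h
  proof -
    have "length (g # ?gs) = p + 1 \<and> (\<forall>f\<in>set (g # ?gs). smooth_on U f)"
      using len gs that(1) by auto
    from mp[OF spec[OF br[unfolded leibniz_bracket_def]] this, THEN conjunct2, THEN conjunct2,
        THEN spec, of 0]
    have "\<forall>f h. smooth_on U f \<and> smooth_on U h \<longrightarrow> (\<forall>u\<in>U.
          br ((g # ?gs)[0 := (\<lambda>v. f v + h v)]) u = br ((g # ?gs)[0 := f]) u + br ((g # ?gs)[0 := h]) u \<and>
          (\<forall>c. br ((g # ?gs)[0 := (\<lambda>v. c * f v)]) u = c * br ((g # ?gs)[0 := f]) u) \<and>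
          br ((g # ?gs)[0 := (\<lambda>v. f v * h v)]) u = f u * br ((g # ?gs)[0 := h]) u + h u * br ((g # ?gs)[0 := f]) u)"
      by (rule mp) simp
    then show ?thesis using that U(2) by blast
  qed
  show ?thesis
    unfolding bracket_coords_def
  proof (rule derivation_eq_sum_partial[where D = "\<lambda>g. br (g # ?gs) u", OF U f])
    show "br (g # ?gs) u = br (h # ?gs) u"
      if "smooth_on U g" "smooth_on U h" "\<And>v. v \<in> U \<Longrightarrow> g v = h v" for g h
      by (rule congr) (use that gs J in \<open>auto simp: nth_Cons split: nat.split\<close>)
  qed (use first in auto)
qed

lemma B_tensor_eq:
  fixes x N :: "real ^ 'n \<Rightarrow> real ^ 'm"
  assumes M: "pseudo_riemannian_metric M \<eta>" and x: "nondegenerate_submanifold M \<eta> U x"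
    and br: "leibniz_bracket p U br" and comp: "compatible_bracket p \<eta> U x br \<gamma> \<epsilon>"
    and N: "smooth_on U N" and u: "u \<in> U"
  shows "B_tensor p \<eta> x br \<gamma> \<epsilon> N i j u
    = - (\<Sum>a\<in>UNIV. \<Sum>b\<in>UNIV. matrix_inv (induced_metric \<eta> x u) $ a $ b
          * partial a x u $ i * nabla_coord \<eta> x N u b $ j)"
proof -
  have U: "open U" and xs: "smooth_on U x" and inv: "invertible (induced_metric \<eta> x u)"
    using x u by (auto simp: nondegenerate_submanifold_def)
  have xd: "x differentiable (at u)" and Nd: "N differentiable (at u)"
    using smooth_on_differentiable xs N u by auto
  let ?E = "\<lambda>a. partial a x u" and ?h = "matrix_inv (induced_metric \<eta> x u)"
  define P where "P = (\<lambda>i I. bracket_coords br x (\<lambda>v. x v $ i) I u)"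
  have P_eq: "bracket_coords br x (\<lambda>v. x v $ i) I u = P i I" for i I
    by (simp add: P_def)
  define V where "V = (\<lambda>b J. bracket_coords br x (\<lambda>v. v $ b) J u)"
  define mm where "mm = multi_metric p (\<eta> (x u))"
  define A :: "'m list set" where "A = multi_indices p"
  \<comment> \<open>The compatibility factor for bare brackets: the two factors
    \<open>1 / sqrt (fact p)\<close> in \<open>P_tensor\<close> turn into \<open>fact p\<close> on
    the other side.\<close>
  define C where "C = fact p * (\<epsilon> * (\<gamma> u)\<^sup>2)"
  define K where "K = (\<lambda>i b. \<Sum>I\<in>A. \<Sum>J\<in>A. P i I * V b J * mm I J)"
  have chain: "bracket_coords br x (\<lambda>v. Y v $ j) J u = (\<Sum>b\<in>UNIV. partial b Y u $ j * V b J)"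
    if "smooth_on U Y" "J \<in> A" for Y :: "real ^ 'n \<Rightarrow> real ^ 'm" and j J
    using bracket_coords_chain[OF U u br xs _ smooth_on_bounded_linear[OF bounded_linear_vec_nth U that(1)], of J] that
    by (simp add: A_def multi_indices_def V_def partial_vec_nth[OF smooth_on_differentiable[OF that(1) u]])
  have contract: "(\<Sum>I\<in>A. \<Sum>J\<in>A. P i I * bracket_coords br x (\<lambda>v. Y v $ j) J u * mm I J)
      = (\<Sum>b\<in>UNIV. partial b Y u $ j * K i b)" if "smooth_on U Y" for Y :: "real ^ 'n \<Rightarrow> real ^ 'm" and i j
  proof -
    have "(\<Sum>I\<in>A. \<Sum>J\<in>A. P i I * bracket_coords br x (\<lambda>v. Y v $ j) J u * mm I J)
      = (\<Sum>I\<in>A. \<Sum>J\<in>A. \<Sum>b\<in>UNIV. partial b Y u $ j * (P i I * V b J * mm I J))"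
      by (intro sum.cong refl) (simp add: chain that sum_distrib_left sum_distrib_right mult_ac)
    also have "\<dots> = (\<Sum>I\<in>A. \<Sum>b\<in>UNIV. \<Sum>J\<in>A. partial b Y u $ j * (P i I * V b J * mm I J))"
      by (intro sum.cong refl sum.swap)
    also have "\<dots> = (\<Sum>b\<in>UNIV. \<Sum>I\<in>A. \<Sum>J\<in>A. partial b Y u $ j * (P i I * V b J * mm I J))"
      by (rule sum.swap)
    finally show ?thesis by (simp add: K_def sum_distrib_left)
  qed
  have \<gamma>: "\<gamma> u > 0" and \<epsilon>: "\<epsilon> \<in> {-1, 1}"
    using comp u by (auto simp: compatible_bracket_def)
  have PP: "(\<Sum>I\<in>A. \<Sum>J\<in>A. P i I * P k J * mm I J)
      = C * (\<Sum>a\<in>UNIV. \<Sum>b\<in>UNIV. ?h $ a $ b * ?E a $ i * ?E b $ k)" for i k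
  proof -
    have "(\<Sum>I\<in>A. \<Sum>J\<in>A. P_tensor p br x i I u * P_tensor p br x k J u * mm I J)
      = \<epsilon> * (\<gamma> u)\<^sup>2 * (\<Sum>a\<in>UNIV. \<Sum>b\<in>UNIV. ?h $ a $ b * ?E a $ i * ?E b $ k)"
      using comp u by (simp add: compatible_bracket_def A_def mm_def partial_vec_nth[OF xd])
    moreover have "P_tensor p br x i I u * P_tensor p br x k J u * mm I J
        = inverse (fact p) * (P i I * P k J * mm I J)" for I J
      by (simp add: P_tensor_def P_def field_simps)
    ultimately have "inverse (fact p) * (\<Sum>I\<in>A. \<Sum>J\<in>A. P i I * P k J * mm I J)
      = \<epsilon> * (\<gamma> u)\<^sup>2 * (\<Sum>a\<in>UNIV. \<Sum>b\<in>UNIV. ?h $ a $ b * ?E a $ i * ?E b $ k)"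
      by (simp add: sum_distrib_left)
    then show ?thesis by (simp add: C_def field_simps)
  qed
  have K: "K i b = C * (\<Sum>a\<in>UNIV. ?h $ a $ b * ?E a $ i)" for i b
  proof -
    \<comment> \<open>The defect of the claimed identity as a vector indexed by \<open>b\<close>.
      Compatibility says that the tangent vector with coordinates \<open>t\<close> is zero, and
      uniqueness of tangent coordinates then forces \<open>t = 0\<close>.\<close>
    define t where "t = (\<chi> b. K i b - C * (\<Sum>a\<in>UNIV. ?h $ a $ b * ?E a $ i))"
    have "(\<Sum>b\<in>UNIV. ?E b $ k * K i b) = C * (\<Sum>b\<in>UNIV. \<Sum>a\<in>UNIV. ?h $ a $ b * ?E a $ i * ?E b $ k)" for k
      using contract[OF xs, of i k] PP[of i k]
      by (subst sum.swap) (simp add: P_def)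
    moreover have "(\<Sum>b\<in>UNIV. t $ b * ?E b $ k) = (\<Sum>b\<in>UNIV. ?E b $ k * K i b)
        - C * (\<Sum>b\<in>UNIV. \<Sum>a\<in>UNIV. ?h $ a $ b * ?E a $ i * ?E b $ k)" for k
      unfolding sum_distrib_left[of C] sum_subtractf[symmetric]
      by (intro sum.cong refl) (simp add: t_def algebra_simps sum_distrib_left)
    ultimately have "(\<Sum>b\<in>UNIV. t $ b *\<^sub>R ?E b) = 0"
      by (simp add: vec_eq_iff)
    then have "0 = (\<Sum>b\<in>UNIV. t $ b *\<^sub>R ?E b)" "0 = (\<Sum>b\<in>UNIV. (0 :: real ^ 'n) $ b *\<^sub>R ?E b)"
      by simp_all
    moreover have "0 \<in> tangent_space x u" by (simp add: tangent_space_def span_zero)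
    ultimately have "t = 0"
      using tangent_coords_unique[OF inv, of 0] by blast
    then show ?thesis by (simp add: t_def vec_eq_iff)
  qed
  have gam: "(\<Sum>I\<in>A. \<Sum>J\<in>A. \<Sum>k\<in>UNIV. \<Sum>l\<in>UNIV. P i I * P k J * mm I J * christoffel \<eta> (x u) j k l * N u $ l)
     = (\<Sum>k\<in>UNIV. \<Sum>l\<in>UNIV. (\<Sum>I\<in>A. \<Sum>J\<in>A. P i I * P k J * mm I J) * christoffel \<eta> (x u) j k l * N u $ l)"
  proof -
    define F where "F = (\<lambda>I J k l. P i I * P k J * mm I J * christoffel \<eta> (x u) j k l * N u $ l)"
    have "(\<Sum>I\<in>A. \<Sum>J\<in>A. \<Sum>k\<in>UNIV. \<Sum>l\<in>UNIV. F I J k l) = (\<Sum>I\<in>A. \<Sum>k\<in>UNIV. \<Sum>J\<in>A. \<Sum>l\<in>UNIV. F I J k l)"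
      by (intro sum.cong refl sum.swap)
    also have "\<dots> = (\<Sum>k\<in>UNIV. \<Sum>I\<in>A. \<Sum>J\<in>A. \<Sum>l\<in>UNIV. F I J k l)"
      by (rule sum.swap)
    also have "\<dots> = (\<Sum>k\<in>UNIV. \<Sum>I\<in>A. \<Sum>l\<in>UNIV. \<Sum>J\<in>A. F I J k l)"
      by (intro sum.cong refl sum.swap)
    also have "\<dots> = (\<Sum>k\<in>UNIV. \<Sum>l\<in>UNIV. \<Sum>I\<in>A. \<Sum>J\<in>A. F I J k l)"
      by (intro sum.cong refl sum.swap)
    finally show ?thesis by (simp add: F_def sum_distrib_right)
  qed
  have "(\<Sum>I\<in>A. \<Sum>J\<in>A. P i I * bracket_coords br x (\<lambda>v. N v $ j) J u * mm I J)
     = C * (\<Sum>a\<in>UNIV. \<Sum>b\<in>UNIV. ?h $ a $ b * ?E a $ i * partial b N u $ j)"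
    unfolding contract[OF N] K by (subst sum.swap) (simp add: sum_distrib_left mult_ac)
  \<comment> \<open>Here the second bracket is \<open>{x^k, x^J}\<close>, so compatibility applies
    as it stands, with no factor stripped.\<close>
  moreover have "(\<Sum>I\<in>A. \<Sum>J\<in>A. \<Sum>k\<in>UNIV. \<Sum>l\<in>UNIV. P i I * P k J * mm I J * christoffel \<eta> (x u) j k l * N u $ l)
     = C * (\<Sum>a\<in>UNIV. \<Sum>b\<in>UNIV. ?h $ a $ b * ?E a $ i *
         (\<Sum>k\<in>UNIV. \<Sum>l\<in>UNIV. christoffel \<eta> (x u) j k l * ?E b $ k * N u $ l))"
  proof -
    define F where "F = (\<lambda>a b k l. C * (?h $ a $ b * ?E a $ i * ?E b $ k * christoffel \<eta> (x u) j k l * N u $ l))"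
    have "(\<Sum>k\<in>UNIV. \<Sum>l\<in>UNIV. \<Sum>a\<in>UNIV. \<Sum>b\<in>UNIV. F a b k l) = (\<Sum>k\<in>UNIV. \<Sum>a\<in>UNIV. \<Sum>l\<in>UNIV. \<Sum>b\<in>UNIV. F a b k l)"
      by (intro sum.cong refl sum.swap)
    also have "\<dots> = (\<Sum>a\<in>UNIV. \<Sum>k\<in>UNIV. \<Sum>l\<in>UNIV. \<Sum>b\<in>UNIV. F a b k l)"
      by (rule sum.swap)
    also have "\<dots> = (\<Sum>a\<in>UNIV. \<Sum>k\<in>UNIV. \<Sum>b\<in>UNIV. \<Sum>l\<in>UNIV. F a b k l)"
      by (intro sum.cong refl sum.swap)
    also have "\<dots> = (\<Sum>a\<in>UNIV. \<Sum>b\<in>UNIV. \<Sum>k\<in>UNIV. \<Sum>l\<in>UNIV. F a b k l)"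
      by (intro sum.cong refl sum.swap)
    finally show ?thesis
      unfolding gam PP by (simp add: F_def sum_distrib_left sum_distrib_right mult_ac)
  qed
  \<comment> \<open>Because \<open>\<epsilon>\<close> squares to 1, the prefactor in
    \<open>B_tensor\<close> cancels \<open>C\<close> up to sign.\<close>
  moreover have "\<epsilon> / ((\<gamma> u)\<^sup>2 * fact p) * C = 1"
    using \<gamma> \<epsilon> by (auto simp: C_def field_simps)
  then have "- \<epsilon> / ((\<gamma> u)\<^sup>2 * fact p) * (C * r) = - r" "\<epsilon> / ((\<gamma> u)\<^sup>2 * fact p) * (C * r) = r" for r
    by (metis (no_types, opaque_lifting) minus_divide_left mult.assoc mult_1 mult_minus_left)+
  ultimately show ?thesis
    unfolding B_tensor_def A_def[symmetric] mm_def[symmetric] P_eq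
    by (simp only:) (simp add: nabla_coord_def distrib_left sum.distrib)
qed

text \<open>A rearrangement of finite sums, hence stated for arbitrary \<open>h\<close>,
  \<open>E\<close>, \<open>n\<close>. The result exhibits the value as a combination of the vectors
  \<open>E a\<close>, with \<open>X\<close> occurring only in the pairings with
  \<open>n b\<close>.\<close>

lemma B_map_eq:
  assumes "\<And>i j. B_tensor p \<eta> x br \<gamma> \<epsilon> N i j u
    = - (\<Sum>a\<in>UNIV. \<Sum>b\<in>UNIV. h $ a $ b * E a $ i * n b $ j)"
  shows "B_map p \<eta> x br \<gamma> \<epsilon> N u X = (\<Sum>a\<in>UNIV. (- (\<Sum>b\<in>UNIV. h $ a $ b * form (\<eta> (x u)) (n b) X)) *\<^sub>R E a)"
proof -
  have "(\<Sum>j\<in>UNIV. \<Sum>k\<in>UNIV. (\<Sum>a\<in>UNIV. \<Sum>b\<in>UNIV. h $ a $ b * E a $ i * n b $ j) * \<eta> (x u) $ j $ k * X $ k)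
     = (\<Sum>a\<in>UNIV. (\<Sum>b\<in>UNIV. h $ a $ b * form (\<eta> (x u)) (n b) X) * E a $ i)" for i
  proof -
    define F where "F = (\<lambda>a b j k. h $ a $ b * E a $ i * n b $ j * \<eta> (x u) $ j $ k * X $ k)"
    have "(\<Sum>j\<in>UNIV. \<Sum>k\<in>UNIV. \<Sum>a\<in>UNIV. \<Sum>b\<in>UNIV. F a b j k) = (\<Sum>j\<in>UNIV. \<Sum>a\<in>UNIV. \<Sum>k\<in>UNIV. \<Sum>b\<in>UNIV. F a b j k)"
      by (intro sum.cong refl sum.swap)
    also have "\<dots> = (\<Sum>a\<in>UNIV. \<Sum>j\<in>UNIV. \<Sum>k\<in>UNIV. \<Sum>b\<in>UNIV. F a b j k)"
      by (rule sum.swap)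
    also have "\<dots> = (\<Sum>a\<in>UNIV. \<Sum>j\<in>UNIV. \<Sum>b\<in>UNIV. \<Sum>k\<in>UNIV. F a b j k)"
      by (intro sum.cong refl sum.swap)
    also have "\<dots> = (\<Sum>a\<in>UNIV. \<Sum>b\<in>UNIV. \<Sum>j\<in>UNIV. \<Sum>k\<in>UNIV. F a b j k)"
      by (intro sum.cong refl sum.swap)
    finally show ?thesis
      by (simp add: F_def form_def sum_distrib_left sum_distrib_right mult_ac)
  qed
  then show ?thesis
    by (simp add: B_map_def assms vec_eq_iff sum_negf)
qed

theorem proposition3p12:
  fixes M :: "(real ^ 'm) set" and \<eta> :: "real ^ 'm \<Rightarrow> real ^ 'm ^ 'm"
    and U :: "(real ^ 'n) set" and x :: "real ^ 'n \<Rightarrow> real ^ 'm"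
    and p :: nat and br :: "(real ^ 'n \<Rightarrow> real) list \<Rightarrow> real ^ 'n \<Rightarrow> real"
    and \<gamma> :: "real ^ 'n \<Rightarrow> real" and \<epsilon> :: real
    and N :: "real ^ 'n \<Rightarrow> real ^ 'm"
  assumes "pseudo_riemannian_metric M \<eta>"
    and "nondegenerate_submanifold M \<eta> U x"
    and "leibniz_bracket p U br"
    and "compatible_bracket p \<eta> U x br \<gamma> \<epsilon>"
    and "smooth_on U N" and "\<forall>u\<in>U. N u \<in> normal_complement \<eta> x u"
  shows "\<forall>u\<in>U. \<forall>X\<in>tangent_space x u. \<forall>N'\<in>normal_complement \<eta> x u.
      B_map p \<eta> x br \<gamma> \<epsilon> N u X = weingarten_map \<eta> x N u X \<and>
      form (\<eta> (x u)) (B_map p \<eta> x br \<gamma> \<epsilon> N u N') X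
        = - form (\<eta> (x u)) (normal_connection \<eta> x N u X) N'"
proof (intro ballI)
  fix u X N'
  assume u: "u \<in> U" and X: "X \<in> tangent_space x u" and N': "N' \<in> normal_complement \<eta> x u"
  define A where "A = \<eta> (x u)"
  define E where "E = (\<lambda>a. partial a x u)"
  define n where "n = nabla_coord \<eta> x N u"
  define g where "g = induced_metric \<eta> x u"
  define h where "h = matrix_inv g"
  define B where "B = B_map p \<eta> x br \<gamma> \<epsilon> N u"
  have inv: "invertible g" and xM: "x u \<in> M"
    using assms(2) u by (auto simp: nondegenerate_submanifold_def g_def)
  have sym: "form A Y Z = form A Z Y" for Y Z
    using assms(1) xM form_commute unfolding A_def pseudo_riemannian_metric_def by blast
  have g: "form A (E a) (E b) = g $ a $ b" for a b
    by (simp add: g_def induced_metric_def A_def E_def)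
  have g_commute: "g $ a $ b = g $ b $ a" for a b
    by (metis g sym)
  have S: "form A (E c) (n b) = form A (E b) (n c)" for b c
    unfolding A_def E_def n_def
    using second_fundamental_form_commute[OF assms(1,2,5) _ u] assms(6) by blast
  have B: "B Y = (\<Sum>a\<in>UNIV. (- (\<Sum>b\<in>UNIV. h $ a $ b * form A (n b) Y)) *\<^sub>R E a)" for Y
    unfolding B_def A_def
    by (rule B_map_eq) (simp add: B_tensor_eq[OF assms(1-5) u] h_def g_def E_def n_def)
  \<comment> \<open>Pairing with \<open>E c\<close> contributes \<open>g $ c $ a\<close>, which
    cancels against the inverse matrix \<open>h\<close> and leaves the single term of index
    \<open>c\<close>.\<close>
  have form_B: "form A (E c) (B Y) = - form A (n c) Y" for c Y
  proof -
    have "form A (E c) (B Y) = - (\<Sum>a\<in>UNIV. \<Sum>b\<in>UNIV. g $ c $ a * h $ a $ b * form A (n b) Y)"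
      unfolding B form_sum_right by (simp add: g sum_distrib_left sum_distrib_right sum_negf mult_ac)
    also have "\<dots> = - (\<Sum>b\<in>UNIV. (\<Sum>a\<in>UNIV. g $ c $ a * h $ a $ b) * form A (n b) Y)"
      by (subst sum.swap) (simp add: sum_distrib_right)
    also have "\<dots> = - form A (n c) Y"
      by (simp add: h_def sum_matrix_inv_right[OF inv] sum_delta_mult)
    finally show ?thesis .
  qed
  obtain t where t: "X = (\<Sum>b\<in>UNIV. t $ b *\<^sub>R E b)"
    using X by (auto simp: tangent_space_iff E_def)
  let ?Y = "nabla_bar \<eta> x N u X"
  have Y: "?Y = (\<Sum>b\<in>UNIV. t $ b *\<^sub>R n b)"
    unfolding t E_def n_def
    using nabla_bar_tangent[OF inv[unfolded g_def] smooth_on_differentiable[OF assms(5) u]] .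
  have tangent: "B X \<in> tangent_space x u"
    unfolding B tangent_space_def E_def by (intro span_sum span_scale span_base rangeI)
  \<comment> \<open>Paired with \<open>E c\<close>, the derivative of \<open>N\<close> along
    \<open>X\<close> contributes the sum of \<open>t $ b * form A (E c) (n b)\<close>, and
    \<open>B X\<close> contributes minus the sum of \<open>t $ b * form A (E b) (n c)\<close>. The
    symmetry \<open>S\<close> makes them cancel.\<close>
  have normal: "?Y + B X \<in> normal_complement \<eta> x u"
    unfolding normal_complement_iff
  proof
    fix c
    have "form A (E c) (?Y + B X) = (\<Sum>b\<in>UNIV. t $ b * form A (E c) (n b)) - form A (n c) X"
      by (simp add: form_add_right Y form_sum_right form_B)
    also have "form A (n c) X = (\<Sum>b\<in>UNIV. t $ b * form A (E c) (n b))"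
      by (simp add: t form_sum_right sym[of "n c"] S[of _ c])
    finally show "form (\<eta> (x u)) (partial c x u) (?Y + B X) = 0"
      by (simp add: A_def E_def)
  qed
  \<comment> \<open>This one splitting, by uniqueness, determines the Weingarten map and the normal
    connection at the same time.\<close>
  have decomp: "?Y = - B X + (?Y + B X)" by simp
  have W: "weingarten_map \<eta> x N u X = B X"
    unfolding weingarten_map_def
    by (rule the1_equality[OF weingarten_decomposition(1)[OF inv[unfolded g_def]]])
      (use tangent normal decomp in blast)
  have D: "normal_connection \<eta> x N u X = ?Y + B X"
    unfolding normal_connection_def
    by (rule the1_equality[OF weingarten_decomposition(2)[OF inv[unfolded g_def]]])
      (use tangent normal decomp in blast)
  \<comment> \<open>The normal derivative differs from the full derivative of \<open>N\<close> by
    the tangential vector \<open>B X\<close>, which is invisible when paired with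
    \<open>N'\<close>.\<close>
  have "form A (B X) N' = 0"
    using N' tangent by (simp add: normal_complement_def A_def)
  then have "form A (normal_connection \<eta> x N u X) N' = (\<Sum>b\<in>UNIV. t $ b * form A (n b) N')"
    by (simp add: D form_add_left Y form_sum_left)
  moreover have "form A (B N') X = - (\<Sum>b\<in>UNIV. t $ b * form A (n b) N')"
    unfolding sym[of "B N'"] t form_sum_left form_B by (simp add: sum_negf)
  ultimately show "B_map p \<eta> x br \<gamma> \<epsilon> N u X = weingarten_map \<eta> x N u X \<and>
      form (\<eta> (x u)) (B_map p \<eta> x br \<gamma> \<epsilon> N u N') X
        = - form (\<eta> (x u)) (normal_connection \<eta> x N u X) N'"
    using W by (simp add: A_def B_def)
qed

end
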